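(* There exists $n_0$ such that for every integer $n\ge n_0$ and every positive integer $b\le\left(1-\frac{30}{\ln^{1/4}n}\right)\frac{n}{\ln n}$, Maker has a strategy to win the $(1:b)$ Maker-Breaker Hamiltonicity game played on the edge set of the complete graph $K_n$ within at most $14n$ of his moves.
   Context: In the $(1:b)$ Maker-Breaker game on the edge set of $K_n$, two players, Maker and Breaker, alternately claim previously unclaimed edges of $K_n$; Breaker moves first and claims $b$ edges per turn, Maker claims $1$ edge per turn (if fewer edges remain than a player should claim, he claims all remaining ones). In the Hamiltonicity game, Maker wins if the graph on the vertex set of $K_n$ formed by his claimed edges contains a Hamilton cycle; Breaker wins otherwise. *)

theory Defs
  imports Complex_Main
begin

definition Kn_edges :: "nat \<Rightarrow> nat set set" where
  "Kn_edges n = {e. \<exists>u v. u < n \<and> v < n \<and> u \<noteq> v \<and> e = {u, v}}"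

definition free_edges :: "nat \<Rightarrow> nat set set \<Rightarrow> nat set set \<Rightarrow> nat set set" where
  "free_edges n M B = Kn_edges n - M - B"

definition breaker_moves :: "nat \<Rightarrow> nat \<Rightarrow> nat set set \<Rightarrow> nat set set \<Rightarrow> nat set set set" where
  "breaker_moves n b M B =
     {S. S \<subseteq> free_edges n M B \<and> card S = min b (card (free_edges n M B))}"

definition has_ham_cycle :: "nat \<Rightarrow> nat set set \<Rightarrow> bool" where
  "has_ham_cycle n M \<longleftrightarrow> n \<ge> 3 \<and>
     (\<exists>vs. distinct vs \<and> set vs = {..<n} \<and>
        (\<forall>i<n. {vs ! i, vs ! ((i + 1) mod n)} \<in> M))"

(* maker_wins_within n b k M B: in the position where Maker owns M, Breaker owns B and
   it is Breaker's turn, Maker can force that his graph contains a Hamilton cycle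
   after at most k further moves of his. *)
fun maker_wins_within :: "nat \<Rightarrow> nat \<Rightarrow> nat \<Rightarrow> nat set set \<Rightarrow> nat set set \<Rightarrow> bool" where
  "maker_wins_within n b 0 M B = has_ham_cycle n M"
| "maker_wins_within n b (Suc k) M B =
     (has_ham_cycle n M \<or>
      (\<forall>S \<in> breaker_moves n b M B.
         \<exists>e \<in> free_edges n M (B \<union> S). maker_wins_within n b k (insert e M) (B \<union> S)))"

end

theory Submission
  imports Defs "HOL-Real_Asymp.Real_Asymp"
begin

text \<open>
  Maker first builds an expander in \<open>12 * n\<close> moves: he always plays at the most dangerous vertex
  \<open>v\<close> at which he has chosen fewer than \<open>12\<close> edges, where danger is the Breaker degree minus
  \<open>2 * b\<close> times the number of edges chosen at \<open>v\<close>. Bounding the average danger of every set of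
  unsatisfied vertices in terms of its size, as in the minimum degree game of Gebauer and Szabo,
  shows that every such \<open>v\<close> keeps at least \<open>n / ln n powr (1/4)\<close> available endpoints. A uniformly
  random endpoint would almost surely make all sets of size up to about
  \<open>6 * n / sqrt (ln n)\<close> expand by a factor of two; Maker derandomises this choice by never
  increasing the expected number of pairs \<open>(U, W)\<close> with \<open>card W = 2 * card U\<close> such that all edges
  chosen at \<open>U\<close> stay inside \<open>U \<union> W\<close>.

  In an expander, Posa rotations of a longest path yield quadratically many pairs whose addition
  closes a path of the same length to a cycle, more than Breaker can occupy within the whole game.
  A cycle that is not Hamiltonian extends to a longer path, either by an existing edge or, if no edge
  leaves it, by one of the many free edges leaving it. So every two moves lengthen the longest path,
  and \<open>2 * n\<close> further moves suffice.
\<close>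

section \<open>Longest paths in expanders\<close>

definition path_in :: "nat \<Rightarrow> nat set set \<Rightarrow> nat list \<Rightarrow> bool" where
  "path_in n M vs \<longleftrightarrow>
     vs \<noteq> [] \<and> distinct vs \<and> set vs \<subseteq> {..<n} \<and> successively (\<lambda>a b. {a, b} \<in> M) vs"

definition nbhd :: "nat \<Rightarrow> nat set set \<Rightarrow> nat set \<Rightarrow> nat set" where
  "nbhd n M U = {x \<in> {..<n} - U. \<exists>y\<in>U. {y, x} \<in> M}"

definition expander :: "nat \<Rightarrow> nat \<Rightarrow> nat set set \<Rightarrow> bool" where
  "expander n k M \<longleftrightarrow>
     (\<forall>U. U \<subseteq> {..<n} \<longrightarrow> U \<noteq> {} \<longrightarrow> card U \<le> k \<longrightarrow> 2 * card U \<le> card (nbhd n M U))"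

lemma path_in_rev: "path_in n M vs \<Longrightarrow> path_in n M (rev vs)"
  by (auto simp: path_in_def insert_commute)

lemma path_in_mono: "path_in n M vs \<Longrightarrow> M \<subseteq> M' \<Longrightarrow> path_in n M' vs"
  unfolding path_in_def by (meson in_mono successively_mono)

lemma path_in_length_le: "path_in n M vs \<Longrightarrow> length vs \<le> n"
  unfolding path_in_def by (metis card_lessThan card_mono distinct_card finite_lessThan)

lemma path_in_snoc:
  "path_in n M vs \<Longrightarrow> x < n \<Longrightarrow> x \<notin> set vs \<Longrightarrow> {last vs, x} \<in> M \<Longrightarrow> path_in n M (vs @ [x])"
  by (auto simp: path_in_def successively_append_iff)

lemma finite_nbhd [simp]: "finite (nbhd n M U)"
  by (simp add: nbhd_def)

lemma expander_mono:
  assumes "expander n k M" "M \<subseteq> M'"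
  shows "expander n k M'"
proof -
  have "card (nbhd n M U) \<le> card (nbhd n M' U)" for U
    using assms(2) by (intro card_mono) (auto simp: nbhd_def)
  then show ?thesis
    using assms(1) unfolding expander_def by (meson le_trans)
qed

section \<open>Order along a path, and Posa rotations\<close>

definition consec :: "'a list \<Rightarrow> 'a \<Rightarrow> 'a \<Rightarrow> bool" where
  "consec P a b \<longleftrightarrow> (\<exists>xs ys. P = xs @ a # b # ys)"

lemma consec_append:
  "consec (xs @ ys) a b \<longleftrightarrow>
     consec xs a b \<or> consec ys a b \<or> (xs \<noteq> [] \<and> ys \<noteq> [] \<and> a = last xs \<and> b = hd ys)"
proof
  assume "consec (xs @ ys) a b"
  then obtain us vs where e: "xs @ ys = us @ a # b # vs"
    by (auto simp: consec_def)
  then consider ws where "xs = us @ ws" "ws @ ys = a # b # vs"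
    | ws where "us = xs @ ws" "ys = ws @ a # b # vs"
    by (auto simp: append_eq_append_conv2)
  then show "consec xs a b \<or> consec ys a b \<or> (xs \<noteq> [] \<and> ys \<noteq> [] \<and> a = last xs \<and> b = hd ys)"
  proof cases
    case 1
    then consider "ws = []" | "ws = [a]" | ts where "ws = a # b # ts"
      by (metis append_eq_Cons_conv)
    then show ?thesis
    proof cases
      case 1
      then have "ys = [] @ a # b # vs" using \<open>ws @ ys = a # b # vs\<close> by simp
      then show ?thesis unfolding consec_def by blast
    qed (use 1 in \<open>auto simp: consec_def\<close>)
  qed (auto simp: consec_def)
next
  assume *: "consec xs a b \<or> consec ys a b \<or> (xs \<noteq> [] \<and> ys \<noteq> [] \<and> a = last xs \<and> b = hd ys)"
  then consider us vs where "xs = us @ a # b # vs" | us vs where "ys = us @ a # b # vs"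
    | "xs = butlast xs @ [a]" "ys = b # tl ys"
    unfolding consec_def by (metis append_butlast_last_id list.collapse)
  then show "consec (xs @ ys) a b"
  proof cases
    case 1 then show ?thesis by (auto simp: consec_def)
  next
    case (2 us vs)
    then have "xs @ ys = (xs @ us) @ a # b # vs" by simp
    then show ?thesis unfolding consec_def by blast
  next
    case 3
    then have "xs @ ys = butlast xs @ a # b # tl ys"
      by (metis append_Cons append_Nil append_assoc)
    then show ?thesis unfolding consec_def by blast
  qed
qed

lemma consec_rev: "consec (rev P) a b \<longleftrightarrow> consec P b a"
proof -
  have "consec (rev P) b a" if "consec P a b" for P and a b :: 'a
  proof -
    from that obtain xs ys where "P = xs @ a # b # ys" by (auto simp: consec_def)
    then have "rev P = rev ys @ b # a # rev xs" by simp
    then show ?thesis unfolding consec_def by blast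
  qed
  from this[of P] this[of "rev P"] show ?thesis by auto
qed

lemma consec_iff_nth: "consec P a b \<longleftrightarrow> (\<exists>i. Suc i < length P \<and> P ! i = a \<and> P ! Suc i = b)"
proof
  assume "consec P a b"
  then obtain xs ys where "P = xs @ a # b # ys" by (auto simp: consec_def)
  then show "\<exists>i. Suc i < length P \<and> P ! i = a \<and> P ! Suc i = b"
    by (intro exI[of _ "length xs"]) (simp add: nth_append)
next
  assume "\<exists>i. Suc i < length P \<and> P ! i = a \<and> P ! Suc i = b"
  then obtain i where "Suc i < length P" "P ! i = a" "P ! Suc i = b" by blast
  then have "P = take i P @ a # b # drop (Suc (Suc i)) P"
    by (metis Cons_nth_drop_Suc Suc_lessD append_take_drop_id)
  then show "consec P a b" unfolding consec_def by blast
qed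

lemma consec_succ_unique: "distinct P \<Longrightarrow> consec P a b \<Longrightarrow> consec P a c \<Longrightarrow> b = c"
  by (auto simp: consec_iff_nth nth_eq_iff_index_eq)

lemma consec_pred_unique: "distinct P \<Longrightarrow> consec P b a \<Longrightarrow> consec P c a \<Longrightarrow> b = c"
  using consec_succ_unique[of "rev P" a b c] by (simp add: consec_rev)

lemma consec_asym: "distinct P \<Longrightarrow> consec P a b \<Longrightarrow> \<not> consec P b a"
  by (auto simp: consec_iff_nth nth_eq_iff_index_eq)

lemma not_consec_hd:
  assumes "distinct P"
  shows "\<not> consec P a (hd P)"
proof
  assume "consec P a (hd P)"
  then obtain i where i: "Suc i < length P" "P ! Suc i = hd P" by (auto simp: consec_iff_nth)
  then have "P ! Suc i = P ! 0" by (cases P) auto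
  with i(1) assms show False by (subst (asm) nth_eq_iff_index_eq) auto
qed

lemma not_consec_last: "distinct P \<Longrightarrow> \<not> consec P (last P) a"
  using not_consec_hd[of "rev P" a] by (simp add: consec_rev hd_rev)

lemma consec_succ_ex:
  assumes "x \<in> set P" "x \<noteq> last P"
  obtains y where "consec P x y"
proof -
  obtain xs ys where "P = xs @ x # ys" using assms(1) by (auto simp: in_set_conv_decomp)
  moreover from this assms(2) have "ys \<noteq> []" by auto
  ultimately show ?thesis
    using that unfolding consec_def by (metis list.collapse)
qed

lemma consec_pred_ex:
  assumes "x \<in> set P" "x \<noteq> hd P"
  obtains y where "consec P y x"
  using consec_succ_ex[of x "rev P"] assms by (auto simp: consec_rev last_rev)

text \<open>Posa rotations with the first vertex fixed: the chord from the last vertex back to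
  \<open>x\<close> replaces the path edge from \<open>x\<close> to \<open>hd ys\<close>, and
  \<open>hd ys\<close> becomes the new last vertex.\<close>

inductive rotated :: "nat set set \<Rightarrow> nat list \<Rightarrow> nat list \<Rightarrow> bool" for M P where
  start: "rotated M P P"
| step: "rotated M P (xs @ x # ys) \<Longrightarrow> ys \<noteq> [] \<Longrightarrow> {x, last ys} \<in> M \<Longrightarrow>
    rotated M P (xs @ x # rev ys)"

lemma rotated_path_in:
  assumes "rotated M P Q" "path_in n M P"
  shows "path_in n M Q \<and> set Q = set P \<and> length Q = length P \<and> hd Q = hd P"
  using assms
proof (induction rule: rotated.induct)
  case (step xs x ys)
  have "successively (\<lambda>a b. {a, b} \<in> M) (rev ys)"
    using step by (auto simp: path_in_def successively_append_iff successively_Cons insert_commute)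
  then show ?case
    using step by (auto simp: path_in_def successively_append_iff successively_Cons hd_rev hd_append)
qed auto

definition rot_ends :: "nat set set \<Rightarrow> nat list \<Rightarrow> nat set" where
  "rot_ends M P = last ` {Q. rotated M P Q}"

text \<open>A rotation destroys a single adjacency, that of \<open>x\<close> and
  \<open>hd ys\<close>, and \<open>hd ys\<close> is then an end of a rotated path. So an adjacency
  of \<open>P\<close> can only be lost if one of its two vertices has been an end; reversing the
  tail merely flips orientations.\<close>

lemma rotated_consec:
  assumes "rotated M P Q" "consec P a b"
  shows "consec Q a b \<or> consec Q b a \<or> a \<in> rot_ends M P \<or> b \<in> rot_ends M P"
  using assms
proof (induction rule: rotated.induct)
  case (step xs x ys)
  have "rotated M P (xs @ x # rev ys)"
    using step.hyps by (rule rotated.step)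
  then have "last (xs @ x # rev ys) \<in> rot_ends M P"
    unfolding rot_ends_def by blast
  then have h: "hd ys \<in> rot_ends M P"
    using step.hyps(2) by (simp add: last_rev)
  have e: "consec (xs @ x # zs) u v \<longleftrightarrow>
     consec (xs @ [x]) u v \<or> consec zs u v \<or> (zs \<noteq> [] \<and> u = x \<and> v = hd zs)" for zs u v
    using consec_append[of "xs @ [x]" zs u v] by simp
  from step.IH[OF step.prems] consider "consec (xs @ [x]) a b" | "consec ys a b"
    | "consec (xs @ [x]) b a" | "consec ys b a" | "a \<in> rot_ends M P" | "b \<in> rot_ends M P"
    unfolding e[of ys] using h by (elim disjE conjE) simp_all
  then show ?case
    unfolding e[of "rev ys"] consec_rev by cases simp_all
qed simp

lemma card_functional_image_le:
  assumes "finite A" "\<And>a b c. r a b \<Longrightarrow> r a c \<Longrightarrow> b = c"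
  shows "finite {b. \<exists>a\<in>A. r a b} \<and> card {b. \<exists>a\<in>A. r a b} \<le> card A"
proof -
  have "{b. \<exists>a\<in>A. r a b} \<subseteq> (\<lambda>a. SOME b. r a b) ` A"
  proof clarify
    fix b a assume "a \<in> A" "r a b"
    then have "(SOME b. r a b) = b" using assms(2) by (blast intro: some_equality)
    then show "b \<in> (\<lambda>a. SOME b. r a b) ` A" using \<open>a \<in> A\<close> by (metis imageI)
  qed
  moreover have "card ((\<lambda>a. SOME b. r a b) ` A) \<le> card A"
    using assms(1) by (rule card_image_le)
  ultimately show ?thesis
    using assms(1) by (metis (no_types, lifting) card_mono finite_imageI finite_subset le_trans)
qed

text \<open>Posa's lemma. If no neighbour of \<open>x\<close> on \<open>P\<close> were ever an end,
  all of them would stay adjacent to \<open>x\<close> in \<open>Q\<close>. But rotating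
  \<open>Q\<close> along the edge from \<open>last Q\<close> to \<open>x\<close> turns the successor
  of \<open>x\<close> into an end, so only the predecessor of \<open>x\<close> in \<open>Q\<close>
  could be such a neighbour, which is too few.\<close>

lemma rot_end_neighbour:
  assumes P: "path_in n M P" and mx: "\<And>Q. path_in n M Q \<Longrightarrow> length Q \<le> length P"
    and x: "x \<in> nbhd n M (rot_ends M P)"
  shows "\<exists>z\<in>rot_ends M P. consec P x z \<or> consec P z x"
proof (rule ccontr)
  assume no: "\<not> ?thesis"
  let ?R = "rot_ends M P"
  obtain Q where Q: "rotated M P Q" and e: "{last Q, x} \<in> M" and xn: "x < n" and xR: "x \<notin> ?R"
    using x by (auto simp: nbhd_def rot_ends_def)
  note pQ = rotated_path_in[OF Q P]
  \<comment> \<open>Otherwise appending \<open>x\<close> to \<open>Q\<close> would contradict the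
    maximality of \<open>P\<close>.\<close>
  have "x \<in> set Q"
    using mx[OF path_in_snoc[of n M Q x]] pQ e xn by fastforce
  then obtain xs ys where Qd: "Q = xs @ x # ys" by (auto simp: in_set_conv_decomp)
  have "last Q \<in> ?R" using Q by (auto simp: rot_ends_def)
  then have ys: "ys \<noteq> []" using xR Qd by auto
  have "rotated M P (xs @ x # rev ys)"
    using Q e ys unfolding Qd by (intro rotated.step) (auto simp: insert_commute)
  then have "last (xs @ x # rev ys) \<in> ?R" unfolding rot_ends_def by blast
  then have h: "hd ys \<in> ?R" using ys by (simp add: last_rev)
  have cQ: "consec Q x (hd ys)"
    using ys unfolding Qd consec_def by (metis list.collapse)
  have dQ: "distinct Q" and dP: "distinct P" using pQ P by (auto simp: path_in_def)
  have pred: "consec Q z x" if "consec P x z \<or> consec P z x" for z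
  proof -
    have z: "z \<notin> ?R" using no that by blast
    then have "consec Q x z \<or> consec Q z x"
      using that rotated_consec[OF Q] xR by blast
    moreover have "\<not> consec Q x z"
      using consec_succ_unique[OF dQ cQ] h z by blast
    ultimately show ?thesis by blast
  qed
  \<comment> \<open>As \<open>last P\<close> is an end and \<open>x\<close> is not, \<open>x\<close>
    has a successor \<open>s\<close> on \<open>P\<close>. Since \<open>s\<close> precedes
    \<open>x\<close> in \<open>Q\<close>, \<open>x\<close> is not the common first vertex, so it
    also has a predecessor \<open>p\<close> on \<open>P\<close>. Both precede \<open>x\<close> in
    \<open>Q\<close>, so they coincide, which is absurd on \<open>P\<close>.\<close>
  have "last P \<in> ?R" unfolding rot_ends_def using rotated.start by blast
  then obtain s where s: "consec P x s"
    using consec_succ_ex[of x P] \<open>x \<in> set Q\<close> pQ xR by metis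
  have sQ: "consec Q s x" using pred s by blast
  then have "x \<noteq> hd P" using not_consec_hd[OF dQ] pQ by metis
  then obtain p where p: "consec P p x"
    using consec_pred_ex[of x P] \<open>x \<in> set Q\<close> pQ by metis
  then have "p = s" using pred sQ consec_pred_unique[OF dQ] by blast
  then show False
    using consec_asym[OF dP s] p by simp
qed

text \<open>By Posa's lemma every outside neighbour of the ends follows or precedes an end on
  \<open>P\<close>. Since \<open>last P\<close> is an end without a successor, there are at most
  \<open>2 * card ?R - 1\<close> such neighbours, so the set of ends is too large for the expansion
  hypothesis to apply.\<close>

lemma card_rot_ends:
  assumes P: "path_in n M P" and mx: "\<And>Q. path_in n M Q \<Longrightarrow> length Q \<le> length P"
    and ex: "expander n k M"
  shows "k < card (rot_ends M P)"
proof (rule ccontr)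
  let ?R = "rot_ends M P"
  assume le: "\<not> k < card ?R"
  have dP: "distinct P" using P by (auto simp: path_in_def)
  have sub: "?R \<subseteq> set P"
  proof
    fix y assume "y \<in> ?R"
    then obtain Q where "rotated M P Q" "y = last Q" by (auto simp: rot_ends_def)
    with rotated_path_in[OF this(1) P] show "y \<in> set P"
      by (metis last_in_set path_in_def)
  qed
  then have fin: "finite ?R" using finite_subset by blast
  have lP: "last P \<in> ?R" unfolding rot_ends_def using rotated.start by blast
  have "nbhd n M ?R \<subseteq> {b. \<exists>a\<in>?R - {last P}. consec P a b} \<union> {b. \<exists>a\<in>?R. consec P b a}"
    using rot_end_neighbour[OF P mx] not_consec_last[OF dP] by fast
  moreover note card_functional_image_le[of "?R - {last P}" "consec P"]
    card_functional_image_le[of ?R "\<lambda>a b. consec P b a"]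
  ultimately have "card (nbhd n M ?R) \<le> card (?R - {last P}) + card ?R"
    using fin consec_succ_unique[OF dP] consec_pred_unique[OF dP]
    by (smt (verit, best) add_mono card_Un_le card_mono finite_Diff finite_UnI le_trans)
  also have "\<dots> < 2 * card ?R"
    using card_Diff1_less[OF fin lP] by simp
  finally show False
    using ex le lP sub P unfolding expander_def path_in_def
    by (metis empty_iff leD leI order_trans)
qed

section \<open>Closing a Hamilton cycle\<close>

lemma finite_Kn_edges [simp]: "finite (Kn_edges n)"
proof -
  have "Kn_edges n \<subseteq> Pow {..<n}" by (auto simp: Kn_edges_def)
  then show ?thesis by (simp add: finite_subset)
qed

lemma Kn_edgesI: "u < n \<Longrightarrow> v < n \<Longrightarrow> u \<noteq> v \<Longrightarrow> {u, v} \<in> Kn_edges n"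
  by (auto simp: Kn_edges_def)

lemma card_insert_le_Suc: "card (insert x A) \<le> Suc (card A)"
  by (cases "finite A") (auto simp: card_insert_if)

lemma breaker_movesD:
  assumes "S \<in> breaker_moves n b M B"
  shows "S \<subseteq> Kn_edges n" "finite S" "card S \<le> b"
  using assms finite_subset[of S "Kn_edges n"] by (auto simp: breaker_moves_def free_edges_def)

lemma path_in_hd_last: "path_in n M vs \<Longrightarrow> hd vs < n \<and> last vs < n"
  unfolding path_in_def using hd_in_set last_in_set by blast

lemma ham_cycle_of_closed_path:
  assumes "path_in n M vs" "{last vs, hd vs} \<in> M" "length vs = n" "n \<ge> 3"
  shows "has_ham_cycle n M"
proof -
  have "set vs = {..<n}"
    using assms unfolding path_in_def
    by (metis card_lessThan card_subset_eq distinct_card finite_lessThan)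
  moreover have "{vs ! i, vs ! ((i + 1) mod n)} \<in> M" if "i < n" for i
  proof (cases "Suc i < n")
    case True
    then show ?thesis
      using assms by (auto simp: path_in_def successively_conv_nth)
  next
    case False
    then have "i = n - 1" using that by simp
    then show ?thesis
      using assms by (auto simp: path_in_def last_conv_nth hd_conv_nth)
  qed
  ultimately show ?thesis
    using assms unfolding has_ham_cycle_def path_in_def by blast
qed

definition closing_edges :: "nat \<Rightarrow> nat set set \<Rightarrow> nat \<Rightarrow> nat set set" where
  "closing_edges n M l = {{hd Q, last Q} | Q. path_in n M Q \<and> length Q = l}"

text \<open>Two rounds of rotations: the first yields more than \<open>k\<close> last vertices;
  reversing each path makes its last vertex the fixed start of a second round with more than
  \<open>k\<close> ends. Each unordered pair arises from at most two ordered ones.\<close>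

lemma many_closing_edges:
  assumes P: "path_in n M P" and mx: "\<And>Q. path_in n M Q \<Longrightarrow> length Q \<le> length P"
    and ex: "expander n k M"
  shows "finite (closing_edges n M (length P)) \<and> k * k < 2 * card (closing_edges n M (length P))"
proof -
  let ?T = "closing_edges n M (length P)"
  define Pr where "Pr = {(hd Q, last Q) | Q. path_in n M Q \<and> length Q = length P}"
  have "Pr \<subseteq> {..<n} \<times> {..<n}"
    using path_in_hd_last by (auto simp: Pr_def)
  then have finP: "finite Pr" by (rule finite_subset) auto
  have T: "?T = (\<lambda>(u, w). {u, w}) ` Pr"
    by (auto simp: closing_edges_def Pr_def image_iff)
  then have finT: "finite ?T" using finP by simp
  have "Pr \<subseteq> (\<Union>e\<in>?T. {p. {fst p, snd p} = e} \<inter> Pr)"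
    unfolding T by force
  then have "card Pr \<le> card (\<Union>e\<in>?T. {p. {fst p, snd p} = e} \<inter> Pr)"
    using finP finT by (intro card_mono) auto
  also have "\<dots> \<le> (\<Sum>e\<in>?T. card ({p. {fst p, snd p} = e} \<inter> Pr))"
    using finT by (rule card_UN_le)
  also have "\<dots> \<le> (\<Sum>e\<in>?T. 2)"
  proof (rule sum_mono)
    fix e assume "e \<in> ?T"
    then obtain u w where e: "e = {u, w}" unfolding T by auto
    have "{p. {fst p, snd p} = e} \<inter> Pr \<subseteq> {(u, w), (w, u)}"
      by (auto simp: e doubleton_eq_iff)
    then have "card ({p. {fst p, snd p} = e} \<inter> Pr) \<le> card {(u, w), (w, u)}"
      by (intro card_mono) auto
    also have "\<dots> \<le> 2" by (cases "u = w") auto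
    finally show "card ({p. {fst p, snd p} = e} \<inter> Pr) \<le> 2" .
  qed
  finally have up: "card Pr \<le> 2 * card ?T" by simp
  let ?R = "rot_ends M P"
  have "k < card ?R" by (rule card_rot_ends[OF P mx ex])
  then have finR: "finite ?R" by (rule_tac ccontr) simp
  have "\<exists>Q. path_in n M Q \<and> length Q = length P \<and> hd Q = w" if w: "w \<in> ?R" for w
  proof -
    obtain Q where Q: "rotated M P Q" "w = last Q" using w by (auto simp: rot_ends_def)
    with rotated_path_in[OF Q(1) P] show ?thesis
      by (intro exI[of _ "rev Q"]) (auto simp: hd_rev path_in_rev)
  qed
  then obtain f where f: "\<And>w. w \<in> ?R \<Longrightarrow> path_in n M (f w) \<and> length (f w) = length P \<and> hd (f w) = w"
    by metis
  have fk: "k < card (rot_ends M (f w))" if "w \<in> ?R" for w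
    using f[OF that] mx by (intro card_rot_ends[OF _ _ ex]) auto
  have sub: "Sigma ?R (\<lambda>w. rot_ends M (f w)) \<subseteq> Pr"
  proof clarify
    fix w z assume w: "w \<in> ?R" and "z \<in> rot_ends M (f w)"
    then obtain Q where Q: "rotated M (f w) Q" "z = last Q" by (auto simp: rot_ends_def)
    with rotated_path_in[OF Q(1), of n] f[OF w] show "(w, z) \<in> Pr"
      unfolding Pr_def by force
  qed
  have "k * k < card ?R * Suc k"
    using \<open>k < card ?R\<close> by (intro mult_strict_mono) auto
  also have "\<dots> \<le> (\<Sum>w\<in>?R. card (rot_ends M (f w)))"
    using sum_bounded_below[of ?R "Suc k" "\<lambda>w. card (rot_ends M (f w))"] fk by (simp add: Suc_le_eq)
  also have "\<dots> = card (Sigma ?R (\<lambda>w. rot_ends M (f w)))"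
  proof (subst card_SigmaI[OF finR])
    show "\<forall>w\<in>?R. finite (rot_ends M (f w))"
      using fk by (metis card.infinite not_less_zero)
  qed simp
  also have "\<dots> \<le> card Pr" using sub finP by (rule card_mono[rotated])
  finally show ?thesis using up finT by simp
qed

lemma isolated_set_large:
  assumes "expander n k M" "U \<subseteq> {..<n}" "U \<noteq> {}" "nbhd n M U = {}"
  shows "k < card U"
proof (rule ccontr)
  assume "\<not> k < card U"
  then have "2 * card U \<le> 0" using assms unfolding expander_def by (metis card.empty not_le)
  then show False using assms(2,3) finite_subset[of U "{..<n}"] by auto
qed

text \<open>Cutting the cycle just after \<open>y\<close> gives a path that ends at \<open>y\<close>
  and can be continued to \<open>x\<close>.\<close>

lemma closed_path_extend:
  assumes P: "path_in n M P" and cl: "{last P, hd P} \<in> M"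
    and y: "y \<in> set P" and x: "x < n" "x \<notin> set P" and e: "{y, x} \<in> M"
  shows "\<exists>Q. path_in n M Q \<and> length Q = Suc (length P)"
proof -
  obtain us ws where P': "P = us @ y # ws" using y by (auto simp: in_set_conv_decomp)
  let ?Q = "ws @ us @ [y]"
  have "successively (\<lambda>a b. {a, b} \<in> M) ?Q"
    using P cl unfolding P' path_in_def
    by (auto simp: successively_append_iff successively_Cons hd_append split: if_splits)
  then have "path_in n M ?Q"
    using P unfolding P' path_in_def by auto
  then have "path_in n M (?Q @ [x])"
    using x e by (intro path_in_snoc) (auto simp: P')
  then show ?thesis by (intro exI[of _ "?Q @ [x]"]) (simp add: P')
qed

text \<open>Each vertex gained costs at most two moves, one to close the path and one to leave the
  cycle; the extra move closes the Hamilton path. The expression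
  \<open>card M + card B + (b + 1) * k\<close> bounds the number of claimed edges at all later times
  and does not increase during a round, so Breaker can never own all of the useful edges, of which
  there are more than \<open>q * q / 2\<close>.\<close>

lemma maker_wins_endgame:
  assumes "n \<ge> 3" "expander n q M" "0 < q" "M \<subseteq> Kn_edges n" "B \<subseteq> Kn_edges n"
    and "2 * (card M + card B + (b + 1) * k) \<le> q * q" "path_in n M P"
    and "2 * (n - length P) + 1 \<le> k"
  shows "maker_wins_within n b k M B"
  using assms(2-)
proof (induction "n - length P" arbitrary: P M B k rule: less_induct)
  case less
  \<comment> \<open>The position after closing a path: one move fewer is needed, and the induction
    hypothesis applies as soon as a longer path exists.\<close>
  have cyc: "maker_wins_within n b k' M' B'"
    if ex: "expander n q M'" and M: "M' \<subseteq> Kn_edges n" and B: "B' \<subseteq> Kn_edges n"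
      and sz: "2 * (card M' + card B' + (b + 1) * k') \<le> q * q"
      and Q: "path_in n M' Q" and cl: "{last Q, hd Q} \<in> M'" and len: "length Q = length P"
      and k: "2 * (n - length P) \<le> k'" for k' M' B' Q
  proof (cases "length Q = n")
    case True
    then have "has_ham_cycle n M'" using ham_cycle_of_closed_path Q cl \<open>n \<ge> 3\<close> by blast
    then show ?thesis by (cases k') auto
  next
    case False
    then have lt: "length P < n" using path_in_length_le[OF Q] len by simp
    show ?thesis
    proof (cases "nbhd n M' (set Q) = {}")
      case False
      then obtain x y where "x < n" "x \<notin> set Q" "y \<in> set Q" "{y, x} \<in> M'"
        by (auto simp: nbhd_def)
      then obtain Q' where "path_in n M' Q'" "length Q' = Suc (length P)"
        using closed_path_extend[OF Q cl] len by metis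
      then show ?thesis
        using lt k by (intro less.hyps[of Q'] ex less.prems(2) M B sz) auto
    next
      \<comment> \<open>No edge of Maker leaves the cycle, so neither its vertex set nor the
        complement has an outside neighbour. By expansion both have more than \<open>q\<close>
        vertices, and more than \<open>q * q\<close> pairs join them, none of them claimed by
        Maker.\<close>
      case nb: True
      define V where "V = {..<n} - set Q"
      have sQ: "set Q \<subseteq> {..<n}" "set Q \<noteq> {}" using Q by (auto simp: path_in_def)
      have cQ: "q < card (set Q)" using isolated_set_large[OF ex sQ nb] .
      have "V \<noteq> {}"
        using lt len sQ Q unfolding V_def path_in_def
        by (metis Diff_eq_empty_iff card_lessThan card_mono distinct_card List.finite_set leD)
      moreover have nbV: "nbhd n M' V = {}"
      proof (rule equals0I)
        fix x assume "x \<in> nbhd n M' V"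
        then obtain y where "y \<in> V" "x \<in> set Q" "{y, x} \<in> M'"
          by (auto simp: nbhd_def V_def)
        then have "y \<in> nbhd n M' (set Q)"
          unfolding nbhd_def V_def by (auto simp: insert_commute intro!: bexI[of _ x])
        with nb show False by simp
      qed
      ultimately have cV: "q < card V"
        using isolated_set_large[OF ex, of V] by (auto simp: V_def)
      obtain k'' where k'': "k' = Suc k''" using lt k by (cases k') auto
      have "\<exists>e \<in> free_edges n M' (B' \<union> S). maker_wins_within n b k'' (insert e M') (B' \<union> S)"
        if S: "S \<in> breaker_moves n b M' B'" for S
      proof -
        let ?C = "(\<lambda>(u, w). {u, w}) ` (set Q \<times> V)"
        have inj: "inj_on (\<lambda>(u, w). {u, w}) (set Q \<times> V)"
          by (auto simp: inj_on_def V_def doubleton_eq_iff)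
        have "card ?C = card (set Q) * card V"
          using inj by (simp add: card_image card_cartesian_product)
        moreover have "q * q < card (set Q) * card V" using cQ cV by (simp add: mult_strict_mono')
        ultimately have big: "q * q < card ?C" by simp
        have fB: "finite B'" using finite_subset[OF B] by simp
        have "card (B' \<union> S) \<le> card B' + b"
          using breaker_movesD(3)[OF S] card_Un_le[of B' S] by linarith
        also have "\<dots> < card ?C" using sz big k'' by simp
        finally obtain e where e: "e \<in> ?C" "e \<notin> B' \<union> S"
          using fB breaker_movesD(2)[OF S] by (meson card_mono finite_UnI leD subsetI)
        then obtain u w where uw: "u \<in> set Q" "w \<in> V" "e = {u, w}" by auto
        have wn: "w < n" "w \<notin> set Q" using uw by (auto simp: V_def)
        have "e \<notin> M'" using nb uw by (auto simp: nbhd_def V_def)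
        moreover have eK: "e \<in> Kn_edges n" using uw sQ wn by (auto intro!: Kn_edgesI)
        ultimately have fr: "e \<in> free_edges n M' (B' \<union> S)" using e by (simp add: free_edges_def)
        have Q': "path_in n (insert e M') Q" using Q path_in_mono by blast
        obtain R where R: "path_in n (insert e M') R" "length R = Suc (length P)"
          using closed_path_extend[OF Q' _ uw(1) wn] cl uw len by auto
        have "card (insert e M') \<le> Suc (card M')" by (rule card_insert_le_Suc)
        then have "2 * (card (insert e M') + card (B' \<union> S) + (b + 1) * k'') \<le> q * q"
          using sz \<open>card (B' \<union> S) \<le> card B' + b\<close> k'' by simp
        then have "maker_wins_within n b k'' (insert e M') (B' \<union> S)"
          using lt k k'' R M B eK breaker_movesD(1)[OF S] less.prems(2) expander_mono[OF ex subset_insertI[of _ e]]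
          by (intro less.hyps[of R]) auto
        then show ?thesis using fr by blast
      qed
      then show ?thesis unfolding k'' by simp
    qed
  qed
  show ?case
  proof (cases "\<exists>Q. path_in n M Q \<and> length Q > length P")
    \<comment> \<open>Passing to a longer existing path costs no move.\<close>
    case True
    then obtain Q where Q: "path_in n M Q" "length Q > length P" by blast
    moreover have "n - length Q < n - length P" using path_in_length_le[OF Q(1)] Q(2) by simp
    ultimately show ?thesis using less.prems by (intro less.hyps[of Q]) auto
  next
    case False
    then have mx: "\<And>Q. path_in n M Q \<Longrightarrow> length Q \<le> length P" by (meson not_le)
    let ?T = "closing_edges n M (length P)"
    note ex = less.prems(1) and M = less.prems(3) and B = less.prems(4) and sz = less.prems(5)
    have T: "finite ?T" "q * q < 2 * card ?T"
      using many_closing_edges[OF less.prems(6) mx ex] by auto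
    show ?thesis
    proof (cases "?T \<inter> M = {}")
      case False
      then obtain Q where "path_in n M Q" "length Q = length P" "{hd Q, last Q} \<in> M"
        by (auto simp: closing_edges_def)
      then show ?thesis
        using less.prems(7) by (intro cyc[OF ex M B sz, of Q]) (auto simp: insert_commute)
    next
      case True
      obtain k'' where k'': "k = Suc k''" using less.prems(7) by (cases k) auto
      have "\<exists>e \<in> free_edges n M (B \<union> S). maker_wins_within n b k'' (insert e M) (B \<union> S)"
        if S: "S \<in> breaker_moves n b M B" for S
      proof -
        have fB: "finite B" using finite_subset[OF B] by simp
        have cB: "card (B \<union> S) \<le> card B + b"
          using breaker_movesD(3)[OF S] card_Un_le[of B S] by linarith
        also have "\<dots> < card ?T" using sz T k'' by simp
        finally obtain e where e: "e \<in> ?T" "e \<notin> B \<union> S"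
          using fB breaker_movesD(2)[OF S] by (meson card_mono finite_UnI leD subsetI)
        then obtain Q where Q: "path_in n M Q" "length Q = length P" "e = {hd Q, last Q}"
          by (auto simp: closing_edges_def)
        \<comment> \<open>Maximality of \<open>Q\<close> gives more than \<open>q >= 1\<close>
          vertices, so the closing pair is not a loop.\<close>
        have "q < card (rot_ends M Q)" using mx Q by (intro card_rot_ends[OF Q(1) _ ex]) auto
        also have "\<dots> \<le> card (set Q)"
        proof (rule card_mono)
          show "rot_ends M Q \<subseteq> set Q"
            using rotated_path_in[OF _ Q(1)] unfolding rot_ends_def path_in_def
            by (metis (mono_tags, lifting) image_subsetI last_in_set mem_Collect_eq)
        qed simp
        finally have "length Q \<ge> 2" using less.prems(2) Q(1) by (simp add: path_in_def distinct_card)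
        then have "hd Q \<noteq> last Q"
          using Q(1) by (cases Q) (auto simp: path_in_def split: if_splits)
        then have eK: "e \<in> Kn_edges n"
          using Q path_in_hd_last[OF Q(1)] by (auto intro!: Kn_edgesI)
        then have fr: "e \<in> free_edges n M (B \<union> S)"
          using e True by (auto simp: free_edges_def)
        have Q': "path_in n (insert e M) Q" using Q path_in_mono by blast
        have "card (insert e M) \<le> Suc (card M)" by (rule card_insert_le_Suc)
        then have "2 * (card (insert e M) + card (B \<union> S) + (b + 1) * k'') \<le> q * q"
          using sz cB k'' by simp
        then have "maker_wins_within n b k'' (insert e M) (B \<union> S)"
          using k'' less.prems(7) Q M B eK breaker_movesD(1)[OF S] expander_mono[OF ex subset_insertI[of _ e]]
          by (intro cyc[OF _ _ _ _ Q']) (auto simp: insert_commute)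
        then show ?thesis using fr by blast
      qed
      then show ?thesis unfolding k'' by simp
    qed
  qed
qed

section \<open>Keeping Breaker degrees small\<close>

definition degree_in :: "nat set set \<Rightarrow> nat \<Rightarrow> nat" where
  "degree_in B v = card {e \<in> B. v \<in> e}"

definition touching :: "nat set set \<Rightarrow> nat set \<Rightarrow> nat" where
  "touching B I = card {e \<in> B. e \<inter> I \<noteq> {}}"

lemma card_Kn_edge: "e \<in> Kn_edges n \<Longrightarrow> finite e \<and> card e = 2"
  by (auto simp: Kn_edges_def)

lemma finite_edge_set: "B \<subseteq> Kn_edges n \<Longrightarrow> finite B"
  using finite_subset finite_Kn_edges by blast

lemma touching_le_sum_degree:
  assumes "finite B" "finite I"
  shows "touching B I \<le> (\<Sum>v\<in>I. degree_in B v)"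
proof -
  have "{e \<in> B. e \<inter> I \<noteq> {}} = (\<Union>v\<in>I. {e \<in> B. v \<in> e})" by auto
  then show ?thesis
    unfolding touching_def degree_in_def using card_UN_le[OF assms(2)] by metis
qed

text \<open>The only edges counted twice on the left join \<open>v\<close> to \<open>I\<close>, and
  there are at most \<open>card I\<close> of them.\<close>

lemma touching_insert_ge:
  assumes B: "B \<subseteq> Kn_edges n" and I: "finite I" "v \<notin> I"
  shows "touching B I + degree_in B v \<le> touching B (insert v I) + card I"
proof -
  let ?A = "{e \<in> B. e \<inter> I \<noteq> {}}" and ?D = "{e \<in> B. v \<in> e}"
  have fin: "finite B" using B by (rule finite_edge_set)
  have "?A \<inter> ?D \<subseteq> (\<lambda>x. {v, x}) ` I"
    using B I(2) by (fastforce simp: Kn_edges_def)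
  then have "card (?A \<inter> ?D) \<le> card I"
    using I(1) by (meson card_image_le card_mono finite_imageI le_trans)
  moreover have "?A \<union> ?D = {e \<in> B. e \<inter> insert v I \<noteq> {}}" by auto
  ultimately show ?thesis
    using card_Un_Int[of ?A ?D] fin unfolding touching_def degree_in_def by simp
qed

lemma touching_Un_le:
  assumes S: "card S \<le> b" "finite S"
  shows "touching (B \<union> S) I \<le> touching B I + b"
proof -
  have "{e \<in> B \<union> S. e \<inter> I \<noteq> {}} = {e \<in> B. e \<inter> I \<noteq> {}} \<union> {e \<in> S. e \<inter> I \<noteq> {}}" by auto
  moreover have "card {e \<in> S. e \<inter> I \<noteq> {}} \<le> card S" using S(2) by (intro card_mono) auto
  ultimately show ?thesis
    using S(1) card_Un_le[of "{e \<in> B. e \<inter> I \<noteq> {}}" "{e \<in> S. e \<inter> I \<noteq> {}}"]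
    unfolding touching_def by simp
qed

lemma degree_in_Un_le:
  "degree_in (B \<union> S) v \<le> degree_in B v + degree_in S v"
proof -
  have "{e \<in> B \<union> S. v \<in> e} = {e \<in> B. v \<in> e} \<union> {e \<in> S. v \<in> e}" by auto
  then show ?thesis unfolding degree_in_def by (metis card_Un_le)
qed

lemma sum_degree_le:
  assumes S: "S \<subseteq> Kn_edges n" and I: "finite I"
  shows "(\<Sum>v\<in>I. degree_in S v) \<le> 2 * card S"
proof -
  have fin: "finite S" using S by (rule finite_edge_set)
  have "(\<Sum>v\<in>I. degree_in S v) = (\<Sum>v\<in>I. \<Sum>e\<in>S. if v \<in> e then 1 else 0)"
    unfolding degree_in_def using fin by (simp add: sum.If_cases Int_def)
  also have "\<dots> = (\<Sum>e\<in>S. \<Sum>v\<in>I. if v \<in> e then 1 else 0)" by (rule sum.swap)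
  also have "\<dots> = (\<Sum>e\<in>S. card (I \<inter> e))"
    using I by (simp add: sum.If_cases)
  also have "\<dots> \<le> (\<Sum>e\<in>S. 2)"
  proof (rule sum_mono)
    fix e assume "e \<in> S"
    then have "finite e" "card e = 2" using S card_Kn_edge by blast+
    then show "card (I \<inter> e) \<le> 2" by (metis card_mono inf_le2)
  qed
  finally show ?thesis by simp
qed

section \<open>Average danger of sets of unsatisfied vertices\<close>

definition danger :: "nat \<Rightarrow> nat set set \<Rightarrow> (nat \<Rightarrow> nat) \<Rightarrow> nat \<Rightarrow> real" where
  "danger b B c v = real (degree_in B v) - 2 * real b * real (c v)"

text \<open>A closed form for the recursion of the average danger as sets grow by one vertex:
  \<open>2 * b / (s + 1)\<close> per step from size \<open>r\<close> on and
  \<open>(b + s) / (s + 1)\<close> below, with harmonic sums replaced by logarithms. The linear term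
  collects the contributions \<open>s / (s + 1)\<close>, which are at most one.\<close>

definition danger_bound :: "nat \<Rightarrow> nat \<Rightarrow> real \<Rightarrow> nat \<Rightarrow> real" where
  "danger_bound n b r s =
     b * (ln n - ln s) + b * (ln n - ln (max r s)) + max 0 (r + 1 - s)"

text \<open>
  Here \<open>c v\<close> counts the edges Maker has chosen at \<open>v\<close>. Sets of fewer than \<open>r\<close> vertices are measured
  by the number of Breaker edges touching them, which grows by only \<open>b\<close> per turn; for large sets
  the sum of degrees, growing by \<open>2 * b\<close>, is good enough.
\<close>

definition danger_controlled :: "nat \<Rightarrow> nat \<Rightarrow> real \<Rightarrow> nat \<Rightarrow> (nat \<Rightarrow> nat) \<Rightarrow> nat set set \<Rightarrow> bool" where
  "danger_controlled n b r d c B \<longleftrightarrow>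
     (\<forall>I. I \<subseteq> {..<n} \<longrightarrow> I \<noteq> {} \<longrightarrow> (\<forall>v\<in>I. c v < d) \<longrightarrow>
        real (touching B I) - 2 * real b * (\<Sum>v\<in>I. real (c v))
          \<le> card I * danger_bound n b r (card I) \<and>
        (r \<le> real (card I) \<longrightarrow> (\<Sum>v\<in>I. danger b B c v) \<le> card I * danger_bound n b r (card I)))"

lemma ln_Suc_diff_ge:
  assumes "0 < s"
  shows "1 / real (Suc s) \<le> ln (real (Suc s)) - ln (real s)"
proof -
  have "ln (real s / real (Suc s)) \<le> real s / real (Suc s) - 1"
    using assms by (intro ln_le_minus_one) auto
  also have "\<dots> = - 1 / real (Suc s)" by (simp add: field_simps)
  finally show ?thesis using assms by (simp add: ln_div)
qed

text \<open>The increment \<open>1 / (s + 1)\<close> is at most \<open>ln (s + 1) - ln s\<close>.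
  For \<open>s < r\<close> the linear term must pay a full unit; the \<open>+ 1\<close> inside it
  secures this even when \<open>r < s + 1\<close>.\<close>

lemma danger_bound_step:
  fixes r :: real and n b s :: nat
  assumes "0 < s" "0 < r"
  shows "r \<le> s \<Longrightarrow> danger_bound n b r (Suc s) + 2 * b / Suc s \<le> danger_bound n b r s"
    and "s < r \<Longrightarrow> danger_bound n b r (Suc s) + (b + s) / Suc s \<le> danger_bound n b r s"
proof -
  have 1: "b / Suc s \<le> b * (ln (Suc s) - ln s)"
    using mult_left_mono[OF ln_Suc_diff_ge[OF assms(1)], of "real b"] by simp
  show "danger_bound n b r (Suc s) + 2 * b / Suc s \<le> danger_bound n b r s" if "r \<le> s"
  proof -
    have "max r (Suc s) = Suc s" "max r s = s" using that by auto
    moreover have "b * (ln n - ln (Suc s)) + b / Suc s \<le> b * (ln n - ln s)"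
      using 1 by (simp add: algebra_simps)
    moreover have "max 0 (r + 1 - Suc s) \<le> max 0 (r + 1 - s)" by simp
    moreover have "2 * b / Suc s = b / Suc s + b / Suc s" by simp
    ultimately show ?thesis unfolding danger_bound_def by linarith
  qed
  show "danger_bound n b r (Suc s) + (b + s) / Suc s \<le> danger_bound n b r s" if "s < r"
  proof -
    have "ln (max r s) \<le> ln (max r (Suc s))" using assms by simp
    then have "b * (ln n - ln (max r (Suc s))) \<le> b * (ln n - ln (max r s))"
      by (intro mult_left_mono) auto
    moreover have "max 0 (r + 1 - Suc s) + 1 = max 0 (r + 1 - s)" using that by simp
    moreover have "(b + s) / Suc s \<le> b / Suc s + 1" by (simp add: add_divide_distrib)
    ultimately show ?thesis
      using 1 unfolding danger_bound_def by (simp add: algebra_simps)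
  qed
qed

lemma danger_bound_nonneg:
  fixes r :: real and n b s :: nat
  assumes "0 < s" "s \<le> n" "r \<le> n"
  shows "0 \<le> danger_bound n b r s"
proof -
  have "ln (real s) \<le> ln (real n)" "ln (max r s) \<le> ln (real n)" using assms by auto
  then show ?thesis unfolding danger_bound_def by simp
qed

lemma danger_controlled_initial:
  fixes r :: real and n b :: nat
  assumes "r \<le> n"
  shows "danger_controlled n b r d (\<lambda>_. 0) {}"
proof -
  have "0 \<le> card I * danger_bound n b r (card I)" if "I \<subseteq> {..<n}" "I \<noteq> {}" for I
  proof -
    have "finite I" using that(1) finite_subset by blast
    then have "0 < card I" "card I \<le> n"
      using that card_mono[OF _ that(1)] by (auto simp: card_gt_0_iff)
    then show ?thesis using danger_bound_nonneg assms by simp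
  qed
  then show ?thesis
    unfolding danger_controlled_def touching_def danger_def degree_in_def by simp
qed

text \<open>If \<open>v\<close> lies in \<open>I\<close>, the drop of \<open>2 * b\<close> at
  \<open>v\<close> offsets whatever Breaker added. If not, \<open>v\<close> has at least the average
  danger of \<open>I\<close>, so the old bound for \<open>insert v I\<close>, with its danger
  removed, bounds \<open>I\<close> at the cost that \<open>danger_bound_step\<close>
  absorbs.\<close>

lemma danger_controlled_step:
  assumes inv: "danger_controlled n b r d c B" and B: "B \<subseteq> Kn_edges n"
    and S: "S \<subseteq> Kn_edges n" "card S \<le> b" and r: "0 < r"
    and v: "v < n" "c v < d"
    and vmax: "\<And>u. u < n \<Longrightarrow> c u < d \<Longrightarrow> danger b (B \<union> S) c u \<le> danger b (B \<union> S) c v"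
  shows "danger_controlled n b r d (c(v := Suc (c v))) (B \<union> S)"
  unfolding danger_controlled_def
proof (intro allI impI)
  let ?c = "c(v := Suc (c v))" and ?B = "B \<union> S" and ?G = "danger_bound n b r"
  fix I assume I: "I \<subseteq> {..<n}" "I \<noteq> {}" and act: "\<forall>u\<in>I. ?c u < d"
  have fI: "finite I" using I(1) finite_subset by blast
  have fS: "finite S" and fB: "finite ?B" using B S by (auto intro: finite_edge_set)
  have act': "\<forall>u\<in>I. c u < d"
    using act v(2) by (metis fun_upd_other)
  define s where "s = card I"
  have s: "0 < s" using fI I(2) by (simp add: s_def card_gt_0_iff)
  have tS: "touching ?B J \<le> touching B J + b" for J
    using touching_Un_le[OF S(2) fS] .
  have dS: "(\<Sum>u\<in>J. danger b ?B c u) \<le> (\<Sum>u\<in>J. danger b B c u) + 2 * b" if "finite J" for J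
  proof -
    have "(\<Sum>u\<in>J. degree_in ?B u) \<le> (\<Sum>u\<in>J. degree_in B u + degree_in S u)"
      using degree_in_Un_le by (intro sum_mono)
    also have "\<dots> \<le> (\<Sum>u\<in>J. degree_in B u) + 2 * b"
      using sum_degree_le[OF S(1) that] S(2) by (simp add: sum.distrib)
    finally have "real (\<Sum>u\<in>J. degree_in ?B u) \<le> real ((\<Sum>u\<in>J. degree_in B u) + 2 * b)"
      by (rule of_nat_mono)
    then show ?thesis unfolding danger_def by (simp add: sum_subtractf)
  qed
  have TD: "real (touching ?B I) - 2 * real b * (\<Sum>u\<in>I. real (c u)) \<le> (\<Sum>u\<in>I. danger b ?B c u)"
    using of_nat_mono[OF touching_le_sum_degree[OF fB fI], where 'a=real]
    unfolding danger_def by (simp add: sum_subtractf sum_distrib_left)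
  show "real (touching ?B I) - 2 * real b * (\<Sum>u\<in>I. real (?c u)) \<le> card I * ?G (card I) \<and>
    (r \<le> real (card I) \<longrightarrow> (\<Sum>u\<in>I. danger b ?B ?c u) \<le> card I * ?G (card I))"
  proof (cases "v \<in> I")
    case True
    have "(\<Sum>u\<in>I. real (?c u)) = (\<Sum>u\<in>I. real (c u)) + 1"
      using fI True by (simp add: sum.remove)
    moreover have "(\<Sum>u\<in>I. danger b ?B ?c u) = (\<Sum>u\<in>I. danger b ?B c u) - 2 * b"
      using fI True by (simp add: sum.remove danger_def algebra_simps)
    moreover have "real (touching B I) - 2 * real b * (\<Sum>u\<in>I. real (c u)) \<le> card I * ?G (card I)"
      "r \<le> real (card I) \<longrightarrow> (\<Sum>u\<in>I. danger b B c u) \<le> card I * ?G (card I)"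
      using inv I act' unfolding danger_controlled_def by auto
    ultimately show ?thesis
      using tS[of I] dS[OF fI] by (auto simp: algebra_simps)
  next
    case False
    let ?J = "insert v I"
    have J: "card ?J = Suc s" using False fI by (simp add: s_def)
    have eqc: "(\<Sum>u\<in>I. real (?c u)) = (\<Sum>u\<in>I. real (c u))"
      "(\<Sum>u\<in>I. danger b ?B ?c u) = (\<Sum>u\<in>I. danger b ?B c u)"
      using False by (auto intro!: sum.cong simp: danger_def)
    have "(\<Sum>u\<in>I. danger b ?B c u) \<le> s * danger b ?B c v"
      using sum_bounded_above[of I "danger b ?B c" "danger b ?B c v"] vmax I act'
      by (auto simp: s_def)
    then have dv: "(\<Sum>u\<in>I. danger b ?B c u) / s \<le> danger b ?B c v"
      using s by (simp add: field_simps)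
    have invJ: "real (touching B ?J) - 2 * real b * (\<Sum>u\<in>?J. real (c u)) \<le> Suc s * ?G (Suc s)"
      "r \<le> Suc s \<Longrightarrow> (\<Sum>u\<in>?J. danger b B c u) \<le> Suc s * ?G (Suc s)"
      using inv[unfolded danger_controlled_def, THEN spec, of ?J] I act' v
      unfolding J by auto
    show ?thesis
    proof (cases "r \<le> s")
      case True
      have "(\<Sum>u\<in>?J. danger b ?B c u) \<le> Suc s * ?G (Suc s) + 2 * b"
        using dS[of ?J] invJ(2) True fI by simp
      \<comment> \<open>The sum plus the average is \<open>(s + 1) / s\<close> times the sum, whence
        the divisor \<open>Suc s\<close> below.\<close>
      then have "(\<Sum>u\<in>I. danger b ?B c u) + (\<Sum>u\<in>I. danger b ?B c u) / s
          \<le> Suc s * ?G (Suc s) + 2 * b"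
        using dv False fI by simp
      then have "(\<Sum>u\<in>I. danger b ?B c u) \<le> s * (?G (Suc s) + 2 * b / Suc s)"
        using s by (simp add: field_simps)
      also have "\<dots> \<le> s * ?G s"
        using danger_bound_step(1)[OF s r True] by (intro mult_left_mono) auto
      finally show ?thesis using TD unfolding eqc s_def by simp
    next
      case False': False
      define T where "T = real (touching ?B I) - 2 * real b * (\<Sum>u\<in>I. real (c u))"
      \<comment> \<open>Counting touched edges, Breaker gains only \<open>b\<close> rather than
        \<open>2 * b\<close>, but the edges between \<open>v\<close> and \<open>I\<close> cost an
        additional \<open>s\<close>.\<close>
      have "real (touching ?B I) + degree_in ?B v \<le> touching ?B ?J + s"
        using of_nat_mono[OF touching_insert_ge[of ?B n I v], where 'a=real] B S fI False
        by (simp add: s_def)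
      moreover have "real (touching ?B ?J) \<le> touching B ?J + b"
        using of_nat_mono[OF tS[of ?J], where 'a=real] by simp
      moreover have "T / s \<le> danger b ?B c v"
        using dv TD s divide_right_mono[of T "\<Sum>u\<in>I. danger b ?B c u" "real s"]
        unfolding T_def by linarith
      ultimately have "T + T / s \<le> Suc s * ?G (Suc s) + b + s"
        using invJ(1) False fI unfolding T_def danger_def by (simp add: algebra_simps)
      then have "T \<le> s * (?G (Suc s) + (b + s) / Suc s)"
        using s by (simp add: field_simps)
      also have "\<dots> \<le> s * ?G s"
        using danger_bound_step(2)[OF s r] False' by (intro mult_left_mono) auto
      finally show ?thesis using False' unfolding eqc s_def T_def by auto
    qed
  qed
qed

text \<open>The control is applied to the singleton of \<open>v\<close>. The chosen edges account
  for at most \<open>2 * d * b\<close>, Breaker's current turn for another \<open>b\<close>.\<close>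

lemma danger_controlled_degree:
  assumes inv: "danger_controlled n b r d c B" and S: "finite S" "card S \<le> b"
    and v: "v < n" "c v < d"
  shows "degree_in (B \<union> S) v \<le> danger_bound n b r 1 + (2 * d + 1) * b"
proof -
  have "real (touching B {v}) - 2 * real b * real (c v) \<le> danger_bound n b r 1"
    using inv v unfolding danger_controlled_def by (auto dest!: spec[of _ "{v}"])
  moreover have "touching B' {v} = degree_in B' v" for B'
    unfolding touching_def degree_in_def by (metis Int_insert_right inf_bot_right insert_not_empty)
  moreover have "real (touching (B \<union> S) {v}) \<le> touching B {v} + b"
    using of_nat_mono[OF touching_Un_le[OF S(2,1)], where 'a=real] by simp
  moreover have "real b * real (c v) \<le> real b * real d"
    using v(2) by (intro mult_left_mono) auto
  ultimately show ?thesis by (simp add: algebra_simps)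
qed

section \<open>Derandomised choice of endpoints\<close>

text \<open>\<open>W\<close> may meet \<open>U\<close>; only
  \<open>card (U \<union> W) \<le> 3 * card U\<close> matters, and a small neighbourhood can then be
  padded freely to size \<open>2 * card U\<close>.\<close>

definition escape_pairs :: "nat \<Rightarrow> nat \<Rightarrow> (nat set \<times> nat set) set" where
  "escape_pairs n k =
     {(U, W). U \<subseteq> {..<n} \<and> W \<subseteq> {..<n} \<and> 1 \<le> card U \<and> card U \<le> k \<and> card W = 2 * card U}"

text \<open>An upper bound for the conditional probability that all choices at \<open>U\<close> end
  in \<open>U \<union> W\<close>, given those made so far: each missing choice is uniform among at
  least \<open>m\<close> endpoints, of which at most \<open>3 * card U\<close> are bad.\<close>

definition trap_weight :: "real \<Rightarrow> nat \<Rightarrow> (nat \<Rightarrow> nat set) \<Rightarrow> nat set \<times> nat set \<Rightarrow> real" where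
  "trap_weight m d out = (\<lambda>(U, W).
     if \<forall>v\<in>U. out v \<subseteq> U \<union> W then (3 * real (card U) / m) ^ (\<Sum>v\<in>U. d - card (out v)) else 0)"

definition trap_potential :: "nat \<Rightarrow> nat \<Rightarrow> real \<Rightarrow> nat \<Rightarrow> (nat \<Rightarrow> nat set) \<Rightarrow> real" where
  "trap_potential n k m d out = (\<Sum>p\<in>escape_pairs n k. trap_weight m d out p)"

lemma finite_escape_pairs [simp]: "finite (escape_pairs n k)"
  by (rule finite_subset[of _ "Pow {..<n} \<times> Pow {..<n}"]) (auto simp: escape_pairs_def)

lemma trap_weight_nonneg: "0 < m \<Longrightarrow> 0 \<le> trap_weight m d out p"
  by (cases p) (simp add: trap_weight_def)

text \<open>Only \<open>v \<in> U\<close> matters. At most \<open>3 * card U\<close> endpoints keep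
  the pair trapped, and for these the exponent drops by one; \<open>3 * card U\<close> is exactly
  \<open>m\<close> times the factor lost, and \<open>m \<le> card X\<close>.\<close>

lemma trap_weight_average:
  assumes m: "0 < m" "m \<le> real (card X)" and X: "finite X"
    and v: "card (out v) < d" "finite (out v)" "X \<inter> out v = {}"
    and UW: "(U, W) \<in> escape_pairs n k"
  shows "(\<Sum>x\<in>X. trap_weight m d (out(v := insert x (out v))) (U, W))
    \<le> card X * trap_weight m d out (U, W)"
proof (cases "v \<in> U")
  case False
  have "(\<Sum>u\<in>U. d - card ((out(v := Y)) u)) = (\<Sum>u\<in>U. d - card (out u))" for Y
    using False by (intro sum.cong) auto
  moreover have "(\<forall>u\<in>U. (out(v := Y)) u \<subseteq> U \<union> W) \<longleftrightarrow> (\<forall>u\<in>U. out u \<subseteq> U \<union> W)" for Y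
    using False by auto
  ultimately have "trap_weight m d (out(v := Y)) (U, W) = trap_weight m d out (U, W)" for Y
    unfolding trap_weight_def prod.case by metis
  then show ?thesis by simp
next
  case vU: True
  show ?thesis
  proof (cases "\<forall>u\<in>U. out u \<subseteq> U \<union> W")
    case False
    then have "\<not> (\<forall>u\<in>U. (out(v := insert x (out v))) u \<subseteq> U \<union> W)" for x
      by (metis fun_upd_apply insert_subset)
    then have "trap_weight m d (out(v := insert x (out v))) (U, W) = 0" for x
      unfolding trap_weight_def prod.case by meson
    moreover have "trap_weight m d out (U, W) = 0"
      unfolding trap_weight_def prod.case using False by meson
    ultimately show ?thesis by simp
  next
    case conf: True
    have fin: "finite U" "finite W"
      using UW finite_subset[of _ "{..<n}"] by (auto simp: escape_pairs_def)
    define p where "p = 3 * real (card U) / m"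
    define E where "E = (\<Sum>u\<in>U - {v}. d - card (out u)) + (d - Suc (card (out v)))"
    have "p \<ge> 0" using m by (simp add: p_def)
    have old: "(\<Sum>u\<in>U. d - card (out u)) = Suc E"
      using v(1) unfolding E_def by (simp add: sum.remove[OF fin(1) vU])
    have new: "(\<Sum>u\<in>U. d - card ((out(v := insert x (out v))) u)) = E" if "x \<in> X" for x
    proof -
      have "x \<notin> out v" using that v(3) by auto
      then have "card (insert x (out v)) = Suc (card (out v))" using v(2) by simp
      moreover have "(\<Sum>u\<in>U - {v}. d - card ((out(v := insert x (out v))) u))
          = (\<Sum>u\<in>U - {v}. d - card (out u))"
        by (intro sum.cong) auto
      ultimately show ?thesis unfolding E_def by (simp add: sum.remove[OF fin(1) vU])
    qed
    have "trap_weight m d (out(v := insert x (out v))) (U, W)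
        = (if x \<in> U \<union> W then p ^ E else 0)" if "x \<in> X" for x
    proof -
      have "(\<forall>u\<in>U. (out(v := insert x (out v))) u \<subseteq> U \<union> W) \<longleftrightarrow> x \<in> U \<union> W"
        using conf vU by auto
      then show ?thesis unfolding trap_weight_def prod.case new[OF that] p_def by simp
    qed
    then have "(\<Sum>x\<in>X. trap_weight m d (out(v := insert x (out v))) (U, W))
        = (\<Sum>x\<in>X. if x \<in> U \<union> W then p ^ E else 0)"
      by (rule sum.cong[OF refl])
    also have "\<dots> = card (X \<inter> (U \<union> W)) * p ^ E"
      using X by (subst sum.If_cases) (auto simp: Int_def)
    also have "\<dots> \<le> 3 * real (card U) * p ^ E"
    proof -
      have "card (X \<inter> (U \<union> W)) \<le> card (U \<union> W)" using fin by (intro card_mono) auto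
      also have "\<dots> \<le> 3 * card U"
        using card_Un_le[of U W] UW by (simp add: escape_pairs_def)
      finally have "real (card (X \<inter> (U \<union> W))) \<le> 3 * real (card U)" by linarith
      then show ?thesis using \<open>p \<ge> 0\<close> by (intro mult_right_mono) auto
    qed
    also have "\<dots> = m * p ^ Suc E" using m by (simp add: p_def)
    also have "\<dots> \<le> card X * p ^ Suc E" using m \<open>p \<ge> 0\<close> by (intro mult_right_mono) auto
    also have "\<dots> = card X * trap_weight m d out (U, W)"
      using conf old by (simp add: trap_weight_def p_def)
    finally show ?thesis .
  qed
qed

text \<open>Derandomisation: a uniformly random endpoint does not increase the expected potential.\<close>

lemma trap_potential_step:
  assumes m: "0 < m" "m \<le> real (card X)" and X: "finite X"
    and v: "card (out v) < d" "finite (out v)" "X \<inter> out v = {}"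
  shows "\<exists>x\<in>X. trap_potential n k m d (out(v := insert x (out v))) \<le> trap_potential n k m d out"
proof (rule ccontr)
  let ?f = "\<lambda>x. trap_potential n k m d (out(v := insert x (out v)))"
  assume "\<not> ?thesis"
  then have "\<And>x. x \<in> X \<Longrightarrow> trap_potential n k m d out < ?f x" by (meson not_le)
  moreover have "X \<noteq> {}" using m by auto
  ultimately have "(\<Sum>x\<in>X. trap_potential n k m d out) < (\<Sum>x\<in>X. ?f x)"
    using X by (intro sum_strict_mono)
  also have "(\<Sum>x\<in>X. ?f x)
      = (\<Sum>p\<in>escape_pairs n k. \<Sum>x\<in>X. trap_weight m d (out(v := insert x (out v))) p)"
    unfolding trap_potential_def by (rule sum.swap)
  also have "\<dots> \<le> (\<Sum>p\<in>escape_pairs n k. card X * trap_weight m d out p)"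
    using trap_weight_average[of m X out v d, OF assms] by (intro sum_mono) auto
  also have "\<dots> = (\<Sum>x\<in>X. trap_potential n k m d out)"
    by (simp add: trap_potential_def sum_distrib_left)
  finally show False by simp
qed

text \<open>Once every vertex has made its \<open>d\<close> choices, all exponents are zero and a
  trapped pair has weight one. A set that fails to expand would be trapped together with its padded
  neighbourhood.\<close>

lemma expander_of_trap_potential:
  assumes pot: "trap_potential n k m d out < 1" and m: "0 < m"
    and out: "\<And>v. v < n \<Longrightarrow> card (out v) = d" "\<And>v. v < n \<Longrightarrow> out v \<subseteq> {..<n}"
    and M: "\<And>v x. v < n \<Longrightarrow> x \<in> out v \<Longrightarrow> {v, x} \<in> M" and k: "2 * k \<le> n"
  shows "expander n k M"
  unfolding expander_def
proof (intro allI impI)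
  fix U assume U: "U \<subseteq> {..<n}" "U \<noteq> {}" "card U \<le> k"
  show "2 * card U \<le> card (nbhd n M U)"
  proof (rule ccontr)
    assume "\<not> ?thesis"
    moreover have "nbhd n M U \<subseteq> {..<n}" by (auto simp: nbhd_def)
    moreover have "2 * card U \<le> card {..<n}" using U(3) k by simp
    ultimately obtain W where W: "nbhd n M U \<subseteq> W" "W \<subseteq> {..<n}" "card W = 2 * card U"
      using exists_subset_between[of "nbhd n M U" "2 * card U" "{..<n}"] by auto
    have "finite U" using U(1) finite_subset by blast
    then have mem: "(U, W) \<in> escape_pairs n k"
      using U W by (auto simp: escape_pairs_def Suc_le_eq card_gt_0_iff)
    have "out v \<subseteq> U \<union> W" if "v \<in> U" for v
      using that U(1) out(2)[of v] M[of v] W(1) by (fastforce simp: nbhd_def)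
    moreover have "(\<Sum>v\<in>U. d - card (out v)) = 0"
      using U(1) out(1) by (intro sum.neutral) auto
    ultimately have "trap_weight m d out (U, W) = 1" by (simp add: trap_weight_def)
    moreover have "trap_weight m d out (U, W) \<le> trap_potential n k m d out"
      unfolding trap_potential_def using mem trap_weight_nonneg[OF m]
      by (intro member_le_sum) auto
    ultimately show False using pot by simp
  qed
qed

section \<open>The potential at the start of the game\<close>

lemma trap_potential_initial:
  "trap_potential n k m d (\<lambda>_. {})
     = (\<Sum>i=1..k. real (n choose i) * real (n choose (2 * i)) * (3 * real i / m) ^ (d * i))"
proof -
  define A where "A i = {U. U \<subseteq> {..<n} \<and> card U = i} \<times> {W. W \<subseteq> {..<n} \<and> card W = 2 * i}" for i
  have fA: "finite (A i)" for i
    by (rule finite_subset[of _ "Pow {..<n} \<times> Pow {..<n}"]) (auto simp: A_def)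
  have "escape_pairs n k = (\<Union>i\<in>{1..k}. A i)"
    by (auto simp: escape_pairs_def A_def)
  then have "trap_potential n k m d (\<lambda>_. {}) = (\<Sum>i=1..k. \<Sum>p\<in>A i. trap_weight m d (\<lambda>_. {}) p)"
    unfolding trap_potential_def using fA by (simp only:, intro sum.UNION_disjoint) (auto simp: A_def)
  also have "\<dots> = (\<Sum>i=1..k. \<Sum>p\<in>A i. (3 * real i / m) ^ (d * i))"
    by (intro sum.cong) (auto simp: A_def trap_weight_def mult.commute)
  also have "\<dots> = (\<Sum>i=1..k. real (n choose i) * real (n choose (2 * i)) * (3 * real i / m) ^ (d * i))"
    by (intro sum.cong) (auto simp: A_def card_cartesian_product n_subsets)
  finally show ?thesis .
qed

text \<open>Going from \<open>i\<close> to \<open>i + 1\<close> multiplies the left side by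
  \<open>(i + 1) * (1 + 1/i) ^ i\<close>, and
  \<open>(1 + 1/i) ^ i \<le> exp 1 \<le> 3\<close>.\<close>

lemma power_self_le_fact: "real i ^ i \<le> 3 ^ i * fact i"
proof (induction i)
  case (Suc i)
  show ?case
  proof (cases "i = 0")
    case False
    have "(1 + 1 / real i) ^ i \<le> exp 1"
      using exp_ge_one_plus_x_over_n_power_n[of i 1] False by simp
    then have e: "(1 + 1 / real i) ^ i \<le> 3" using exp_le by linarith
    have "real (Suc i) ^ Suc i = real (Suc i) * ((1 + 1 / real i) ^ i * real i ^ i)"
      using False by (simp add: power_mult_distrib[symmetric] algebra_simps)
    also have "\<dots> \<le> real (Suc i) * (3 * (3 ^ i * fact i))"
      using e Suc.IH by (intro mult_left_mono mult_mono) auto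
    finally show ?thesis by (simp add: algebra_simps)
  qed simp
qed simp

lemma binomial_le_power:
  assumes "0 < i"
  shows "real (n choose i) \<le> (3 * real n / real i) ^ i"
proof -
  have "real (n choose i) * real i ^ i \<le> real (n choose i) * (3 ^ i * fact i)"
    using power_self_le_fact by (intro mult_left_mono) auto
  also have "\<dots> = 3 ^ i * real ((n choose i) * fact i)" by simp
  also have "\<dots> \<le> 3 ^ i * real (n ^ i)"
    using binomial_fact_pow by (intro mult_left_mono of_nat_mono) auto
  finally show ?thesis
    using assms by (simp add: power_divide power_mult_distrib field_simps)
qed

lemma sum_quarter_powers_less: "(\<Sum>i=1..k. (1 / 4 :: real) ^ i) < 1"
proof -
  have "(\<Sum>i=1..k. (1 / 4 :: real) ^ i) = (1 - (1 / 4) ^ k) / 3"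
    by (induction k) (simp_all add: algebra_simps)
  also have "\<dots> < 1"
  proof -
    have "(1 - q) / 3 < 1" if "0 \<le> q" for q :: real using that by simp
    from this[of "(1 / 4) ^ k"] show ?thesis by simp
  qed
  finally show ?thesis .
qed

text \<open>The pairs with \<open>card U = i\<close> contribute at most the \<open>i\<close>-th
  power of \<open>3 ^ 15 * n ^ 3 * i ^ 9 / m ^ 12\<close>. This base increases with
  \<open>i\<close>, so the case \<open>i = k\<close> makes it at most \<open>1 / 4\<close>
  throughout.\<close>

lemma trap_potential_initial_less:
  assumes m: "0 < m" and small: "4 * 3 ^ 15 * real n ^ 3 * real k ^ 9 \<le> m ^ 12"
  shows "trap_potential n k m 12 (\<lambda>_. {}) < 1"
proof -
  have "real (n choose i) * real (n choose (2 * i)) * (3 * real i / m) ^ (12 * i) \<le> (1 / 4) ^ i"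
    if i: "i \<in> {1..k}" for i
  proof -
    have i0: "0 < i" using i by simp
    have "real (n choose (2 * i)) \<le> (3 * real n / (2 * real i)) ^ (2 * i)"
      using binomial_le_power[of "2 * i" n] i0 by simp
    \<comment> \<open>Weakening the denominator gives both binomials the same base, so that they
      merge into a cube.\<close>
    also have "\<dots> \<le> (3 * real n / real i) ^ (2 * i)"
      using i0 by (intro power_mono divide_left_mono) auto
    finally have "real (n choose i) * real (n choose (2 * i)) \<le> (3 * real n / real i) ^ i * (3 * real n / real i) ^ (2 * i)"
      using binomial_le_power[OF i0, of n] by (intro mult_mono) auto
    also have "\<dots> = ((3 * real n / real i) ^ 3) ^ i"
      by (simp flip: power_add power_mult)
    finally have "real (n choose i) * real (n choose (2 * i)) * (3 * real i / m) ^ (12 * i)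
        \<le> ((3 * real n / real i) ^ 3) ^ i * ((3 * real i / m) ^ 12) ^ i"
      using m by (simp add: power_mult mult_right_mono)
    also have "\<dots> = ((3 * real n / real i) ^ 3 * (3 * real i / m) ^ 12) ^ i"
      by (simp add: power_mult_distrib)
    also have "\<dots> \<le> (1 / 4) ^ i"
    proof (rule power_mono)
      have "(3 * real n / real i) ^ 3 * (3 * real i / m) ^ 12 = 3 ^ 15 * real n ^ 3 * real i ^ 9 / m ^ 12"
      proof -
        have "(3 * real n / real i) ^ 3 * (3 * real i / m) ^ 12
            = (3 * real n / real i) ^ 3 * (3 * real i / m) ^ 3 * (3 * real i / m) ^ 9"
          by (simp only: mult.assoc power_add[symmetric]) simp
        also have "(3 * real n / real i) ^ 3 * (3 * real i / m) ^ 3 = (9 * real n / m) ^ 3"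
          using i0 by (simp add: power_mult_distrib[symmetric])
        also have "(9 * real n / m) ^ 3 * (3 * real i / m) ^ 9
            = 3 ^ 15 * real n ^ 3 * real i ^ 9 / m ^ 12"
          by (simp add: power_divide power_mult_distrib)
        finally show ?thesis .
      qed
      also have "\<dots> \<le> 3 ^ 15 * real n ^ 3 * real k ^ 9 / m ^ 12"
        using i m by (intro divide_right_mono mult_left_mono power_mono) auto
      also have "\<dots> \<le> 1 / 4" using small m by (simp add: field_simps)
      finally show "(3 * real n / real i) ^ 3 * (3 * real i / m) ^ 12 \<le> 1 / 4" .
    qed (use m in simp)
    finally show ?thesis .
  qed
  then have "trap_potential n k m 12 (\<lambda>_. {}) \<le> (\<Sum>i=1..k. (1 / 4) ^ i)"
    unfolding trap_potential_initial by (rule sum_mono)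
  also have "\<dots> < 1" by (rule sum_quarter_powers_less)
  finally show ?thesis .
qed

section \<open>Building the expander\<close>

definition in_nbrs :: "nat \<Rightarrow> (nat \<Rightarrow> nat set) \<Rightarrow> nat \<Rightarrow> nat set" where
  "in_nbrs n out x = {u \<in> {..<n}. x \<in> out u}"

text \<open>
  \<open>out v\<close> records the endpoints of the edges that Maker chose when playing at \<open>v\<close>. Bounding the
  in-degrees by \<open>D + 1\<close> ensures that Maker's own edges do not use up the free edges at a vertex.
\<close>

definition building_state ::
  "nat \<Rightarrow> nat \<Rightarrow> nat \<Rightarrow> real \<Rightarrow> real \<Rightarrow> nat \<Rightarrow> (nat \<Rightarrow> nat set) \<Rightarrow> nat set set \<Rightarrow> nat set set \<Rightarrow> bool"
where
  "building_state n b k m r D out M B \<longleftrightarrow>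
     M = {{v, x} | v x. v < n \<and> x \<in> out v} \<and>
     (\<forall>v<n. out v \<subseteq> {..<n} - {v} \<and> card (out v) \<le> 12) \<and>
     B \<subseteq> Kn_edges n \<and> card B \<le> b * (\<Sum>v<n. card (out v)) \<and>
     (\<forall>x<n. card (in_nbrs n out x) \<le> Suc D) \<and>
     danger_controlled n b r 12 (\<lambda>v. card (out v)) B \<and>
     trap_potential n k m 12 out < 1"

lemma sum_in_nbrs:
  assumes "\<And>v. v < n \<Longrightarrow> out v \<subseteq> {..<n}"
  shows "(\<Sum>x<n. card (in_nbrs n out x)) = (\<Sum>v<n. card (out v))"
proof -
  have "(\<Sum>x<n. card (in_nbrs n out x)) = (\<Sum>x<n. \<Sum>v<n. if x \<in> out v then 1 else 0)"
    by (simp add: in_nbrs_def sum.If_cases Int_def)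
  also have "\<dots> = (\<Sum>v<n. \<Sum>x<n. if x \<in> out v then 1 else 0)" by (rule sum.swap)
  also have "\<dots> = (\<Sum>v<n. card (out v))"
  proof (rule sum.cong[OF refl])
    fix v assume "v \<in> {..<n}"
    then have "{..<n} \<inter> out v = out v" using assms by auto
    then show "(\<Sum>x<n. if x \<in> out v then 1 else 0) = card (out v)" by (simp add: sum.If_cases)
  qed
  finally show ?thesis .
qed

text \<open>The lost endpoints are \<open>v\<close> itself, at most 11 chosen at \<open>v\<close>,
  at most \<open>D + 1\<close> that chose \<open>v\<close>, the Breaker neighbours of
  \<open>v\<close>, and the vertices of in-degree above \<open>D\<close>. Of the last there are at
  most \<open>12 * n / (D + 1)\<close>, as all in-degrees sum to at most \<open>12 * n\<close>. The
  factor 25 is \<open>2 * 12 + 1\<close>.\<close>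

lemma many_free_endpoints:
  assumes st: "building_state n b k m r D out M B" and S: "S \<subseteq> Kn_edges n" "card S \<le> b"
    and v: "v < n" "card (out v) < 12"
    and m: "m + 14 + real D + 12 * real n / (real D + 1) + danger_bound n b r 1 + 25 * real b \<le> real n"
  shows "m \<le> card {x \<in> {..<n}. x \<noteq> v \<and> {v, x} \<notin> M \<union> (B \<union> S) \<and> card (in_nbrs n out x) \<le> D}"
proof -
  define X where "X = {x \<in> {..<n}. x \<noteq> v \<and> {v, x} \<notin> M \<union> (B \<union> S) \<and> card (in_nbrs n out x) \<le> D}"
  define H where "H = {x \<in> {..<n}. D < card (in_nbrs n out x)}"
  define Y where "Y = {x \<in> {..<n}. {v, x} \<in> B \<union> S}"
  have M: "M = {{v, x} | v x. v < n \<and> x \<in> out v}"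
    and out: "\<And>v. v < n \<Longrightarrow> out v \<subseteq> {..<n} - {v} \<and> card (out v) \<le> 12"
    and B: "B \<subseteq> Kn_edges n" and ind: "\<And>x. x < n \<Longrightarrow> card (in_nbrs n out x) \<le> Suc D"
    and dc: "danger_controlled n b r 12 (\<lambda>v. card (out v)) B"
    using st by (auto simp: building_state_def)
  have fin: "finite (out v)" "finite X" "finite H" "finite Y" "finite (in_nbrs n out v)"
    using out[OF v(1)] finite_subset[of "out v" "{..<n} - {v}"]
    by (auto simp: X_def H_def Y_def in_nbrs_def)
  have "{v, x} \<in> M \<Longrightarrow> x \<in> out v \<or> x \<in> in_nbrs n out v" for x
    unfolding M in_nbrs_def by (auto simp: doubleton_eq_iff)
  then have "{..<n} \<subseteq> X \<union> ({v} \<union> (out v \<union> (in_nbrs n out v \<union> (Y \<union> H))))"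
    unfolding X_def H_def Y_def by (auto simp: not_le)
  then have "card {..<n} \<le> card (X \<union> ({v} \<union> (out v \<union> (in_nbrs n out v \<union> (Y \<union> H)))))"
    using fin by (intro card_mono) auto
  also have "\<dots> \<le> card X + (card {v} + (card (out v) + (card (in_nbrs n out v) + (card Y + card H))))"
    by (intro order.trans[OF card_Un_le] add_left_mono)
       (intro order.trans[OF card_Un_le] add_left_mono order.refl)+
  also have "\<dots> \<le> card X + (1 + (11 + (Suc D + (card Y + card H))))"
    using v(2) ind[OF v(1)] by simp
  finally have total: "n \<le> card X + (13 + D + card Y + card H)" by simp
  have "(\<lambda>x. {v, x}) ` Y \<subseteq> {e \<in> B \<union> S. v \<in> e}" by (auto simp: Y_def)
  moreover have "inj_on (\<lambda>x. {v, x}) Y" by (auto simp: inj_on_def doubleton_eq_iff)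
  moreover have "finite (B \<union> S)" using B S(1) finite_edge_set by blast
  ultimately have "card Y \<le> degree_in (B \<union> S) v"
    unfolding degree_in_def by (intro card_inj_on_le) auto
  moreover have "real (degree_in (B \<union> S) v) \<le> danger_bound n b r 1 + 25 * real b"
    using danger_controlled_degree[OF dc finite_edge_set[OF S(1)] S(2) v] by simp
  ultimately have Y: "card Y \<le> danger_bound n b r 1 + 25 * real b" by linarith
  have "card H * Suc D = (\<Sum>x\<in>H. Suc D)" by simp
  also have "\<dots> \<le> (\<Sum>x\<in>H. card (in_nbrs n out x))"
    by (intro sum_mono) (auto simp: H_def)
  also have "\<dots> \<le> (\<Sum>x<n. card (in_nbrs n out x))"
    by (intro sum_mono2) (auto simp: H_def)
  also have "\<dots> = (\<Sum>u<n. card (out u))" using out by (intro sum_in_nbrs) blast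
  also have "\<dots> \<le> (\<Sum>u<n. 12)" using out by (intro sum_mono) auto
  finally have "card H * Suc D \<le> 12 * n" by simp
  then have "real (card H) * (real D + 1) \<le> 12 * real n"
    using of_nat_mono[of "card H * Suc D" "12 * n", where 'a=real] by (simp add: algebra_simps)
  then have "card H \<le> 12 * real n / (real D + 1)" by (simp add: field_simps)
  then have "m \<le> card X" using m Y total by linarith
  then show ?thesis unfolding X_def .
qed

lemma building_state_step:
  assumes st: "building_state n b k m r D out M B" and S: "S \<in> breaker_moves n b M B"
    and m: "0 < m" "m + 14 + real D + 12 * real n / (real D + 1) + danger_bound n b r 1 + 25 * real b \<le> real n"
    and r: "0 < r" and act: "\<exists>v<n. card (out v) < 12"
  shows "\<exists>v x. v < n \<and> card (out v) < 12 \<and> x \<notin> out v \<and> finite (out v) \<and>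
    {v, x} \<in> free_edges n M (B \<union> S) \<and>
    building_state n b k m r D (out(v := insert x (out v))) (insert {v, x} M) (B \<union> S)"
proof -
  have M: "M = {{v, x} | v x. v < n \<and> x \<in> out v}"
    and out: "\<And>v. v < n \<Longrightarrow> out v \<subseteq> {..<n} - {v} \<and> card (out v) \<le> 12"
    and B: "B \<subseteq> Kn_edges n" and cB: "card B \<le> b * (\<Sum>v<n. card (out v))"
    and ind: "\<And>x. x < n \<Longrightarrow> card (in_nbrs n out x) \<le> Suc D"
    and dc: "danger_controlled n b r 12 (\<lambda>v. card (out v)) B"
    and tp: "trap_potential n k m 12 out < 1"
    using st by (auto simp: building_state_def)
  note S' = breaker_movesD[OF S]
  let ?A = "{v \<in> {..<n}. card (out v) < 12}"
  let ?c = "\<lambda>v. card (out v)"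
  have "finite ?A" "?A \<noteq> {}" using act by auto
  \<comment> \<open>Danger is compared after Breaker's move, as
    \<open>danger_controlled_step\<close> demands.\<close>
  define f where "f = danger b (B \<union> S) ?c"
  have "Max (f ` ?A) \<in> f ` ?A" using \<open>finite ?A\<close> \<open>?A \<noteq> {}\<close> by (intro Max_in) auto
  then obtain v where v: "v \<in> ?A" "Max (f ` ?A) = f v" by auto
  have vmax: "f u \<le> f v" if "u < n" "card (out u) < 12" for u
    unfolding v(2)[symmetric] using that by (intro Max_ge) auto
  from v have v': "v < n" "card (out v) < 12" by auto
  define X where "X = {x \<in> {..<n}. x \<noteq> v \<and> {v, x} \<notin> M \<union> (B \<union> S) \<and> card (in_nbrs n out x) \<le> D}"
  have mX: "m \<le> card X"
    unfolding X_def by (rule many_free_endpoints[OF st S'(1,3) v' m(2)])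
  have fo: "finite (out v)" using out[OF v'(1)] finite_subset[of "out v" "{..<n} - {v}"] by auto
  have Xo: "X \<inter> out v = {}"
    using v'(1) unfolding X_def M by auto
  have "finite X" by (simp add: X_def)
  obtain x where x: "x \<in> X"
    and tp': "trap_potential n k m 12 (out(v := insert x (out v))) \<le> trap_potential n k m 12 out"
    using trap_potential_step[where out=out and v=v, OF m(1) mX \<open>finite X\<close> v'(2) fo Xo] by blast
  let ?out = "out(v := insert x (out v))"
  have xo: "x \<notin> out v" using x Xo by auto
  have xn: "x < n" "x \<noteq> v" using x by (auto simp: X_def)
  have card': "card (?out u) = (?c(v := Suc (?c v))) u" for u
    using xo fo by auto
  have fr: "{v, x} \<in> free_edges n M (B \<union> S)"
    using x v' Kn_edgesI[of v n x] by (auto simp: X_def free_edges_def)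
  have "building_state n b k m r D ?out (insert {v, x} M) (B \<union> S)"
    unfolding building_state_def
  proof (intro conjI)
    show "insert {v, x} M = {{u, w} | u w. u < n \<and> w \<in> ?out u}"
      unfolding M using v'(1) by (auto split: if_splits)
    show "\<forall>u<n. ?out u \<subseteq> {..<n} - {u} \<and> card (?out u) \<le> 12"
      using out v' xn card' by auto
    show "B \<union> S \<subseteq> Kn_edges n" using B S'(1) by blast
    have "(\<Sum>u<n. card (?out u)) = (\<Sum>u<n. card (out u)) + 1"
      unfolding card' using v'(1) by (simp add: sum.remove[of "{..<n}" v])
    then show "card (B \<union> S) \<le> b * (\<Sum>u<n. card (?out u))"
      using card_Un_le[of B S] S'(3) cB by simp
    show "\<forall>y<n. card (in_nbrs n ?out y) \<le> Suc D"
    proof (intro allI impI)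
      fix y assume y: "y < n"
      show "card (in_nbrs n ?out y) \<le> Suc D"
      proof (cases "y = x")
        case True
        have "in_nbrs n ?out y \<subseteq> insert v (in_nbrs n out x)"
          using True by (auto simp: in_nbrs_def split: if_splits)
        then have "card (in_nbrs n ?out y) \<le> card (insert v (in_nbrs n out x))"
          by (intro card_mono) (auto simp: in_nbrs_def)
        also have "\<dots> \<le> Suc (card (in_nbrs n out x))" by (rule card_insert_le_Suc)
        finally show ?thesis using x by (auto simp: X_def)
      next
        case False
        then have "in_nbrs n ?out y = in_nbrs n out y"
          by (auto simp: in_nbrs_def split: if_splits)
        then show ?thesis using ind[OF y] by simp
      qed
    qed
    show "danger_controlled n b r 12 (\<lambda>u. card (?out u)) (B \<union> S)"
      unfolding card'
      using danger_controlled_step[OF dc B S'(1,3) r v'] vmax unfolding f_def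
      by (simp add: fun_upd_def)
    show "trap_potential n k m 12 ?out < 1" using tp tp' by simp
  qed
  then show ?thesis using v' xo fo fr by blast
qed

text \<open>Induction on the number of choices still to be made. When none remain, Maker owns at
  most \<open>12 * n\<close> and Breaker at most \<open>12 * n * b\<close> edges; with the
  \<open>2 * n\<close> rounds to come this makes \<open>14 * n * (b + 1)\<close>, and doubling it
  explains the constant 28.\<close>

lemma maker_wins_from_building_state:
  assumes n: "n \<ge> 3" and k: "0 < k" "2 * k \<le> n" "28 * n * (b + 1) \<le> k * k"
    and m: "0 < m" "m + 14 + real D + 12 * real n / (real D + 1) + danger_bound n b r 1 + 25 * real b \<le> real n"
    and r: "0 < r"
    and st: "building_state n b k m r D out M B"
  shows "maker_wins_within n b (2 * n + (\<Sum>v<n. 12 - card (out v))) M B"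
  using st
proof (induction "\<Sum>v<n. 12 - card (out v)" arbitrary: out M B)
  case 0
  have M: "M = {{v, x} | v x. v < n \<and> x \<in> out v}"
    and out: "\<And>v. v < n \<Longrightarrow> out v \<subseteq> {..<n} - {v} \<and> card (out v) \<le> 12"
    and B: "B \<subseteq> Kn_edges n" and cB: "card B \<le> b * (\<Sum>v<n. card (out v))"
    and tp: "trap_potential n k m 12 out < 1"
    using 0(2) by (auto simp: building_state_def)
  have out12: "card (out v) = 12" if "v < n" for v
    using 0(1) out[OF that] that by (force simp: sum_eq_0_iff)
  have ex: "expander n k M"
    using out out12 k(2) M by (intro expander_of_trap_potential[OF tp m(1)]) blast+
  have MK: "M \<subseteq> Kn_edges n"
    unfolding M using out by (fastforce simp: Kn_edges_def)
  have "M = (\<Union>v<n. (\<lambda>x. {v, x}) ` out v)" unfolding M by auto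
  then have "card M \<le> (\<Sum>v<n. card ((\<lambda>x. {v, x}) ` out v))"
    using card_UN_le[of "{..<n}"] by simp
  also have "\<dots> \<le> (\<Sum>v<n. 12)"
  proof (rule sum_mono)
    fix v assume v: "v \<in> {..<n}"
    then have "finite (out v)" using out12[of v] card_ge_0_finite by force
    then show "card ((\<lambda>x. {v, x}) ` out v) \<le> 12"
      using card_image_le[of "out v"] out12[of v] v by fastforce
  qed
  finally have cM: "card M \<le> 12 * n" by simp
  have "card B \<le> 12 * n * b" using cB out12 by (simp add: algebra_simps)
  then have "2 * (card M + card B + (b + 1) * (2 * n)) \<le> k * k"
    using cM k(3) by (simp add: algebra_simps)
  \<comment> \<open>The endgame starts from a single vertex and needs
    \<open>2 * (n - 1) + 1 \<le> 2 * n\<close> moves.\<close>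
  moreover have "path_in n M [0]" using n by (simp add: path_in_def)
  ultimately have "maker_wins_within n b (2 * n) M B"
    using n by (intro maker_wins_endgame[OF n ex k(1) MK B, of b "2 * n" "[0]"]) auto
  then show ?case using 0(1) by simp
next
  case (Suc j)
  have act: "\<exists>v<n. card (out v) < 12"
  proof (rule ccontr)
    assume "\<not> ?thesis"
    then have "(\<Sum>v<n. 12 - card (out v)) = 0" by (intro sum.neutral) auto
    then show False using Suc(2) by simp
  qed
  have "\<exists>e \<in> free_edges n M (B \<union> S). maker_wins_within n b (2 * n + j) (insert e M) (B \<union> S)"
    if S: "S \<in> breaker_moves n b M B" for S
  proof -
    obtain v x where v: "v < n" "card (out v) < 12" "x \<notin> out v" "finite (out v)"
      and fr: "{v, x} \<in> free_edges n M (B \<union> S)"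
      and st': "building_state n b k m r D (out(v := insert x (out v))) (insert {v, x} M) (B \<union> S)"
      using building_state_step[OF Suc(3) S m r act] by blast
    let ?out = "out(v := insert x (out v))"
    have "(\<Sum>u\<in>{..<n} - {v}. 12 - card (?out u)) = (\<Sum>u\<in>{..<n} - {v}. 12 - card (out u))"
      by (intro sum.cong) auto
    then have "j = (\<Sum>u<n. 12 - card (?out u))"
      using v Suc(2) by (simp add: sum.remove[of "{..<n}" v])
    from Suc(1)[OF this st'] this fr show ?thesis by auto
  qed
  then show ?case unfolding Suc(2)[symmetric] by simp
qed

lemma building_state_initial:
  assumes "r \<le> real n" "0 < m" "4 * 3 ^ 15 * real n ^ 3 * real k ^ 9 \<le> m ^ 12"
  shows "building_state n b k m r D (\<lambda>_. {}) {} {}"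
  using danger_controlled_initial[OF assms(1)] trap_potential_initial_less[OF assms(2,3)]
  by (simp add: building_state_def in_nbrs_def)

lemma maker_wins_criterion:
  assumes "n \<ge> 3" "0 < k" "2 * k \<le> n" "28 * n * (b + 1) \<le> k * k"
    and "0 < m" "m + 14 + real D + 12 * real n / (real D + 1) + danger_bound n b r 1 + 25 * real b \<le> real n"
    and "0 < r" "r \<le> real n" "4 * 3 ^ 15 * real n ^ 3 * real k ^ 9 \<le> m ^ 12"
  shows "maker_wins_within n b (14 * n) {} {}"
  using maker_wins_from_building_state[OF assms(1-7) building_state_initial[OF assms(8,5,9)]]
  by simp

section \<open>Choice of parameters\<close>

text \<open>With \<open>L = ln n\<close>, the fifth estimate is where the bias is limited: the term
  \<open>30 / L powr (1/4)\<close> saves about \<open>30 * n / L powr (1/4)\<close>, which covers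
  \<open>m = n / L powr (1/4)\<close>, while all other corrections are of order at most
  \<open>n * ln L / L\<close>. In the last one both sides have order \<open>n ^ 12\<close>, divided
  by \<open>L powr (9/2)\<close> on the left and by \<open>L ^ 3\<close> on the right.\<close>

lemma eventually_parameters:
  shows "\<forall>\<^sub>F n in sequentially. 1 < ln (real n)"
    and "\<forall>\<^sub>F n in sequentially. 6 * real n / sqrt (ln (real n)) + 1 \<le> 7 * real n / sqrt (ln (real n))"
    and "\<forall>\<^sub>F n in sequentially. 14 / sqrt (ln (real n)) \<le> 1"
    and "\<forall>\<^sub>F n in sequentially. 28 * ln (real n) \<le> 8 * real n"
    and "\<forall>\<^sub>F n in sequentially. real n / ln (real n) powr (1/4) + 15 + ln (real n) + 12 * real n / ln (real n)
      + (1 - 30 / ln (real n) powr (1/4)) * real n / ln (real n) * (ln (real n) + ln (ln (real n)) + 25)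
      + real n / ln (real n) \<le> real n"
    and "\<forall>\<^sub>F n in sequentially. 4 * 3 ^ 15 * real n ^ 3 * (7 * real n / sqrt (ln (real n))) ^ 9
      \<le> (real n / ln (real n) powr (1/4)) ^ 12"
  by real_asymp+

theorem theorem1:
  shows "\<exists>n0::nat. \<forall>n\<ge>n0. \<forall>b::nat. 0 < b \<and>
           real b \<le> (1 - 30 / (ln (real n)) powr (1/4)) * real n / ln (real n) \<longrightarrow>
           maker_wins_within n b (14 * n) {} {}"
proof -
  have "\<forall>\<^sub>F n in sequentially. \<forall>b::nat. 0 < b \<and>
           real b \<le> (1 - 30 / (ln (real n)) powr (1/4)) * real n / ln (real n) \<longrightarrow>
           maker_wins_within n b (14 * n) {} {}"
    using eventually_parameters eventually_ge_at_top[of "3 :: nat"]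
  proof eventually_elim
    case (elim n)
    define L where "L = ln (real n)"
    \<comment> \<open>The constant 6 gives \<open>k * k \<ge> 36 * n * n / L\<close>, which exceeds
      \<open>28 * n * (b + 1)\<close> for \<open>b \<le> n / L\<close>.\<close>
    define k where "k = nat \<lceil>6 * real n / sqrt L\<rceil>"
    \<comment> \<open>This makes both \<open>D\<close> and \<open>12 * n / (D + 1)\<close>
      negligible compared with \<open>m\<close>.\<close>
    define D where "D = nat \<lceil>L\<rceil>"
    define m where "m = real n / L powr (1/4)"
    \<comment> \<open>This threshold reduces the second logarithm of \<open>danger_bound\<close> at
      size one from \<open>L\<close> to \<open>ln L\<close>, at an additive cost of only
      \<open>r\<close>.\<close>
    define r where "r = real n / L"
    note ev = elim[folded L_def]
    have L: "1 < L" and n: "n \<ge> 3" using ev by auto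
    have "0 < 6 * real n / sqrt L" using L n by simp
    then have k_ge: "6 * real n / sqrt L \<le> real k" and k0: "0 < k" and
      k_le: "real k \<le> 6 * real n / sqrt L + 1"
      unfolding k_def by linarith+
    have k_le': "real k \<le> 7 * real n / sqrt L" using k_le ev(2) by linarith
    have "2 * real k \<le> 14 / sqrt L * real n" using k_le' by simp
    also have "\<dots> \<le> 1 * real n" using ev(3) by (intro mult_right_mono) auto
    finally have k2: "2 * k \<le> n" by linarith
    have D: "L \<le> real D" "real D \<le> L + 1" unfolding D_def using L by linarith+
    have m0: "0 < m" unfolding m_def using L n by simp
    have "r \<le> real n" unfolding r_def using L n by (simp add: field_simps)
    have "L \<le> real n" using ln_le_minus_one[of "real n"] n unfolding L_def by simp
    then have r1: "1 \<le> r" unfolding r_def using L by (simp add: field_simps)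
    have lnr: "ln r = L - ln L"
      unfolding r_def using L n by (simp add: ln_div L_def)
    have k9: "4 * 3 ^ 15 * real n ^ 3 * real k ^ 9 \<le> m ^ 12"
    proof -
      have "4 * 3 ^ 15 * real n ^ 3 * real k ^ 9 \<le> 4 * 3 ^ 15 * real n ^ 3 * (7 * real n / sqrt L) ^ 9"
        using k_le' by (intro mult_left_mono power_mono) auto
      also have "\<dots> \<le> m ^ 12" using ev(6) unfolding m_def .
      finally show ?thesis .
    qed
    show ?case
    proof (intro allI impI, elim conjE)
      fix b :: nat
      assume "real b \<le> (1 - 30 / (ln (real n)) powr (1/4)) * real n / ln (real n)"
      then have b: "real b \<le> (1 - 30 / L powr (1/4)) * real n / L" by (simp only: L_def)
      also have "\<dots> \<le> 1 * real n / L"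
        using L by (intro divide_right_mono mult_right_mono) auto
      finally have bn: "real b \<le> real n / L" by simp
      have "28 * real n * (real b + 1) \<le> 28 * real n * (real n / L + 1)"
        using bn by (intro mult_left_mono) auto
      also have "\<dots> \<le> 36 * (real n * real n) / L"
      proof -
        have "real n * (28 * L) \<le> real n * (8 * real n)" using ev(4) by (intro mult_left_mono) auto
        then show ?thesis using L by (simp add: field_simps)
      qed
      also have "\<dots> = (6 * real n / sqrt L) * (6 * real n / sqrt L)"
        using L by (simp add: field_simps)
      also have "\<dots> \<le> real k * real k"
        using k_ge L by (intro mult_mono) auto
      finally have "real (28 * n * (b + 1)) \<le> real (k * k)" by (simp add: algebra_simps)
      then have kk: "28 * n * (b + 1) \<le> k * k" by (simp only: of_nat_le_iff)
      have db: "danger_bound n b r 1 = real b * L + real b * ln L + r"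
        using r1 lnr unfolding danger_bound_def by (simp add: L_def[symmetric] max_def)
      have "12 * real n / (real D + 1) \<le> 12 * real n / L"
        using D L by (intro divide_left_mono) auto
      moreover have "real b * (L + ln L + 25)
          \<le> (1 - 30 / L powr (1/4)) * real n / L * (L + ln L + 25)"
        using b L by (intro mult_right_mono) auto
      moreover have "danger_bound n b r 1 + 25 * real b = real b * (L + ln L + 25) + r"
        unfolding db by (simp add: algebra_simps)
      ultimately have "m + 14 + real D + 12 * real n / (real D + 1) + danger_bound n b r 1
          + 25 * real b \<le> real n"
        using ev(5)[folded m_def r_def] D by linarith
      with n k0 k2 kk m0 show "maker_wins_within n b (14 * n) {} {}"
        using r1 \<open>r \<le> real n\<close> k9 by (intro maker_wins_criterion[of n k b m D r]) auto
    qed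
  qed
  then show ?thesis unfolding eventually_sequentially .
qed

end
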